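(* Let $\mathbf{k}$ be an algebraically closed field. For each singular irreducible cubic hypersurface $X\subseteq\mathbb{P}^3_{\mathbf{k}}$, there exists an element $\varphi\in\mathrm{Aut}(\mathbb{P}^3\setminus X)$ that does not extend to an element of $\mathrm{Aut}(\mathbb{P}^3)$.
   Context: An irreducible cubic hypersurface is the zero locus of an irreducible homogeneous polynomial of degree $3$. Automorphisms are automorphisms of varieties over $\mathbf{k}$. *)

theory Defs
  imports
    "HOL-Analysis.Analysis"
    "HOL-Library.Poly_Mapping"
    "HOL-Computational_Algebra.Polynomial"
begin

text \<open>
  Polynomials over \<open>'k\<close> in the variables \<open>x\<^sub>i\<close>, \<open>i :: 'n\<close>, as elements of the monoid algebra of
  the exponent vectors; ring operations and \<^const>\<open>irreducible\<close> are those of the library.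
\<close>

type_synonym ('k, 'n) mpol = "('n \<Rightarrow>\<^sub>0 nat) \<Rightarrow>\<^sub>0 'k"

definition mpol_eval :: "('k::field, 'n::finite) mpol \<Rightarrow> 'k ^ 'n \<Rightarrow> 'k" where
  "mpol_eval f v =
     (\<Sum>m\<in>Poly_Mapping.keys f.
        Poly_Mapping.lookup f m * (\<Prod>i\<in>UNIV. (v $ i) ^ Poly_Mapping.lookup m i))"

text \<open>The zero polynomial is homogeneous of every degree.\<close>

definition homogeneous :: "nat \<Rightarrow> ('k::field, 'n::finite) mpol \<Rightarrow> bool" where
  "homogeneous d f \<longleftrightarrow>
     (\<forall>m\<in>Poly_Mapping.keys f. (\<Sum>i\<in>UNIV. Poly_Mapping.lookup m i) = d)"

text \<open>
  The truncated subtraction of exponents is harmless: if \<open>x\<^sub>i\<close> does not occur in the monomial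
  \<open>m\<close>, then the coefficient of the term vanishes.
\<close>

definition partial_deriv :: "'n \<Rightarrow> ('k::field, 'n::finite) mpol \<Rightarrow> ('k, 'n) mpol" where
  "partial_deriv i f =
     (\<Sum>m\<in>Poly_Mapping.keys f.
        Poly_Mapping.single (m - Poly_Mapping.single i 1)
          (of_nat (Poly_Mapping.lookup m i) * Poly_Mapping.lookup f m))"

text \<open>
  Points of projective space with homogeneous coordinates indexed by \<open>'n\<close> (so the dimension is
  \<open>CARD('n) - 1\<close>): non-zero vectors up to non-zero scalars.  \<open>abs_proj v\<close> is the point \<open>[v]\<close>
  and is meaningful only for \<open>v \<noteq> 0\<close>.
\<close>

definition proj_rel :: "('k::field) ^ ('n::finite) \<Rightarrow> 'k ^ 'n \<Rightarrow> bool" where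
  "proj_rel v w \<longleftrightarrow> v \<noteq> 0 \<and> (\<exists>c. c \<noteq> 0 \<and> w = c *s v)"

quotient_type (overloaded) ('k, 'n) proj = "('k::field) ^ ('n::finite)" / partial: proj_rel
proof (rule part_equivpI)
  have "proj_rel (1 :: 'k ^ 'n) 1"
    unfolding proj_rel_def by (auto simp: vec_eq_iff intro!: exI[of _ 1])
  then show "\<exists>v :: 'k ^ 'n. proj_rel v v" by blast
  show "symp (proj_rel :: 'k ^ 'n \<Rightarrow> _)"
  proof (rule sympI)
    fix v w :: "'k ^ 'n"
    assume "proj_rel v w"
    then obtain c where c: "v \<noteq> 0" "c \<noteq> 0" "w = c *s v" unfolding proj_rel_def by blast
    then have "w \<noteq> 0" "v = inverse c *s w" by (auto simp: vec_eq_iff)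
    with c show "proj_rel w v" unfolding proj_rel_def by (metis inverse_nonzero_iff_nonzero)
  qed
  show "transp (proj_rel :: 'k ^ 'n \<Rightarrow> _)"
  proof (rule transpI)
    fix u v w :: "'k ^ 'n"
    assume "proj_rel u v" "proj_rel v w"
    then obtain c d where "u \<noteq> 0" "c \<noteq> 0" "v = c *s u" "d \<noteq> 0" "w = d *s v"
      unfolding proj_rel_def by blast
    then show "proj_rel u w"
      unfolding proj_rel_def by (intro conjI exI[of _ "d * c"]) (auto simp: vec_eq_iff)
  qed
qed

definition hom_coords :: "('k::field, 'n::finite) proj \<Rightarrow> ('k ^ 'n) set" where
  "hom_coords p = {v. v \<noteq> 0 \<and> abs_proj v = p}"

definition zero_locus :: "('k::field, 'n::finite) mpol \<Rightarrow> ('k, 'n) proj set" where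
  "zero_locus f = {p. \<forall>v\<in>hom_coords p. mpol_eval f v = 0}"

text \<open>
  Jacobian criterion at a point of the hypersurface \<open>f = 0\<close>; it describes the singular points of
  the variety \<^term>\<open>zero_locus f\<close> when \<open>f\<close> is homogeneous and irreducible.  That the point lies on
  the hypersurface is required separately, since in characteristic dividing the degree this does
  not follow from Euler's relation.
\<close>

definition singular_point :: "('k::field, 'n::finite) mpol \<Rightarrow> ('k, 'n) proj \<Rightarrow> bool" where
  "singular_point f p \<longleftrightarrow>
     p \<in> zero_locus f \<and> (\<forall>i. p \<in> zero_locus (partial_deriv i f))"

text \<open>The complements of hypersurfaces form a basis of the Zariski topology.\<close>

definition zariski :: "('k::field, 'n::finite) proj topology" where
  "zariski = topology_generated_by {- zero_locus f | f d. homogeneous d f}"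

text \<open>
  Regular functions on a subset \<open>V\<close> of projective space (in practice: quasi-projective) are locally
  quotients of two forms of equal degree.  Functions on \<open>V\<close> and maps defined on \<open>V\<close> are represented
  by total functions whose values outside \<open>V\<close> play no role.
\<close>

definition regular_on :: "('k::field, 'n::finite) proj set \<Rightarrow> (('k, 'n) proj \<Rightarrow> 'k) \<Rightarrow> bool" where
  "regular_on V f \<longleftrightarrow>
     (\<forall>p\<in>V. \<exists>W d g h.
        openin (subtopology zariski V) W \<and> p \<in> W \<and> homogeneous d g \<and> homogeneous d h \<and>
        (\<forall>q\<in>W. \<forall>v\<in>hom_coords q. mpol_eval h v \<noteq> 0 \<and> f q = mpol_eval g v / mpol_eval h v))"

text \<open>A morphism is a continuous map that pulls back regular functions to regular functions.\<close>

definition morphism_on ::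
    "('k::field, 'n::finite) proj set \<Rightarrow> ('k, 'm::finite) proj set \<Rightarrow>
     (('k, 'n) proj \<Rightarrow> ('k, 'm) proj) \<Rightarrow> bool" where
  "morphism_on Y Z \<phi> \<longleftrightarrow>
     continuous_map (subtopology zariski Y) (subtopology zariski Z) \<phi> \<and>
     (\<forall>V f. openin (subtopology zariski Z) V \<longrightarrow> regular_on V f \<longrightarrow>
        regular_on {p \<in> Y. \<phi> p \<in> V} (f \<circ> \<phi>))"

definition Aut :: "('k::field, 'n::finite) proj set \<Rightarrow> (('k, 'n) proj \<Rightarrow> ('k, 'n) proj) set" where
  "Aut Y = {\<phi>. morphism_on Y Y \<phi> \<and>
     (\<exists>\<psi>. morphism_on Y Y \<psi> \<and> (\<forall>p\<in>Y. \<psi> (\<phi> p) = p \<and> \<phi> (\<psi> p) = p))}"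

end

theory Submission
  imports Defs
begin

text \<open>
  Let \<open>e\<close> represent a singular point of \<open>X\<close>.  Then \<open>F (q + t e) = F q + t Q q\<close> for a quadratic form \<open>Q\<close>
  that is invariant under translation by \<open>e\<close>.

  If \<open>Q = 0\<close>, then \<open>X\<close> is a cone and \<open>q \<mapsto> q + ((l q)\<^sup>4 / F q) e\<close>, with \<open>l\<close> a linear form vanishing at \<open>e\<close>,
  is an automorphism of the complement of \<open>X\<close>.  Otherwise choose a zero \<open>v\<close> of \<open>Q\<close> not proportional to \<open>e\<close>;
  with its help one finds a unipotent one-parameter group \<open>\<rho>\<close> of linear maps, commuting with translation by
  \<open>e\<close>, that preserves \<open>Q\<close> and a linear form \<open>l\<close> with \<open>l e = 0\<close>.  The map
  \<open>q \<mapsto> \<rho> s q - ((F (\<rho> s q) - F q) / Q q) e\<close> preserves \<open>F\<close>, and taking \<open>s = l Q / F\<close> makes it homogeneous of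
  degree one and regular where \<open>F \<noteq> 0\<close>, because the difference \<open>F (\<rho> s q) - F q\<close> is divisible by \<open>s\<close>.

  At a point of \<open>X\<close> with \<open>l Q \<noteq> 0\<close> the parameter \<open>s\<close> has a pole, so an extension to \<open>X\<close> would send the
  point to the limit of its orbit at infinity.  Points of one orbit have the same limit, so the extension
  would not be injective.
\<close>

section \<open>Polynomials in one variable over an algebraically closed field\<close>

text \<open>If the field were finite, one plus the product of all linear factors
  \<open>[:- a, 1:]\<close> would be non-constant without a root.\<close>

lemma infinite_UNIV_alg_closed: "infinite (UNIV :: 'k::alg_closed_field set)"
proof
  assume fin: "finite (UNIV :: 'k set)"
  define p :: "'k poly" where "p = 1 + (\<Prod>a\<in>UNIV. [:- a, 1:])"
  have "degree (\<Prod>a\<in>UNIV. [:- a, 1:] :: 'k poly) = card (UNIV :: 'k set)"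
    by (subst degree_prod_eq_sum_degree) auto
  moreover have "card (UNIV :: 'k set) > 0"
    using fin by (simp add: card_gt_0_iff)
  ultimately have "degree p > 0"
    unfolding p_def by (metis degree_1 degree_add_eq_right)
  then obtain x where "poly p x = 0"
    using alg_closed_imp_poly_has_root by blast
  moreover have "poly p x = 1"
    using fin by (simp add: p_def poly_prod prod_zero_iff)
  ultimately show False by simp
qed

lemma poly_0_if_infinite_roots:
  fixes p :: "'k::alg_closed_field poly"
  assumes "infinite {t. poly p t = 0}"
  shows "p = 0"
  using assms poly_roots_finite by blast

lemma poly_0_if_cofinite_roots:
  fixes p :: "'k::alg_closed_field poly"
  assumes "finite S" and "\<And>t. t \<notin> S \<Longrightarrow> poly p t = 0"
  shows "p = 0"
proof (rule poly_0_if_infinite_roots)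
  have "- S \<subseteq> {t. poly p t = 0}" using assms(2) by auto
  moreover have "infinite (- S)"
    using assms(1) infinite_UNIV_alg_closed by (simp add: finite_compl)
  ultimately show "infinite {t. poly p t = 0}" using finite_subset by blast
qed

text \<open>Lets an identity be checked away from finitely many bad parameters, where denominators
  vanish, and then be read off at those parameters, above all at 0.\<close>

lemma poly_eq_if_cofinite_eq:
  fixes p q :: "'k::alg_closed_field poly"
  assumes "finite S" and "\<And>t. t \<notin> S \<Longrightarrow> poly p t = poly q t"
  shows "p = q"
  using poly_0_if_cofinite_roots[of S "p - q"] assms by simp

section \<open>Forms\<close>

text \<open>Homogeneous polynomial functions, generated inductively so that closure and restriction
  properties follow by rule induction. As for \<open>homogeneous\<close>, zero has every
  degree.\<close>

inductive form :: "nat \<Rightarrow> (('k::field) ^ ('n::finite) \<Rightarrow> 'k) \<Rightarrow> bool" where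
  form_zero: "form d (\<lambda>_. 0)"
| form_const: "form 0 (\<lambda>_. c)"
| form_coord: "form 1 (\<lambda>v. v $ i)"
| form_add: "form d f \<Longrightarrow> form d g \<Longrightarrow> form d (\<lambda>v. f v + g v)"
| form_mult: "form d f \<Longrightarrow> form e g \<Longrightarrow> form (d + e) (\<lambda>v. f v * g v)"

lemma form_mult': "form d f \<Longrightarrow> form e g \<Longrightarrow> n = d + e \<Longrightarrow> form n (\<lambda>v. f v * g v)"
  using form_mult by blast

lemma form_scale: "form d f \<Longrightarrow> form d (\<lambda>v. c * f v)"
  using form_mult'[OF form_const] by fastforce

lemma form_uminus: "form d f \<Longrightarrow> form d (\<lambda>v. - f v)"
  using form_scale[of d f "-1"] by simp

lemma form_diff: "form d f \<Longrightarrow> form d g \<Longrightarrow> form d (\<lambda>v. f v - g v)"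
  using form_add[OF _ form_uminus] by fastforce

lemma form_sum: "(\<And>i. i \<in> I \<Longrightarrow> form d (f i)) \<Longrightarrow> form d (\<lambda>v. \<Sum>i\<in>I. f i v)"
  by (induction I rule: infinite_finite_induct) (auto intro: form_zero form_add)

lemma form_power: "form d f \<Longrightarrow> form (n * d) (\<lambda>v. f v ^ n)"
  by (induction n) (auto intro: form_const form_mult')

lemma form_prod:
  "finite I \<Longrightarrow> (\<And>i. i \<in> I \<Longrightarrow> form (d i) (f i)) \<Longrightarrow> form (\<Sum>i\<in>I. d i) (\<lambda>v. \<Prod>i\<in>I. f i v)"
proof (induction I rule: finite_induct)
  case (insert i I)
  then have "form (d i + (\<Sum>i\<in>I. d i)) (\<lambda>v. f i v * (\<Prod>i\<in>I. f i v))"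
    by (intro form_mult) auto
  then show ?case using insert.hyps by simp
qed (simp add: form_const)

lemma form_compose:
  assumes "form d f" and "\<And>i. form e (\<lambda>v. g v $ i)"
  shows "form (d * e) (\<lambda>v. f (g v))"
  using assms by (induction rule: form.induct)
    (auto intro: form_zero form_const form_add form_mult' simp: add_mult_distrib)

lemma form_homogeneous: "form d f \<Longrightarrow> f (c *s v) = c ^ d * f v"
  by (induction rule: form.induct) (auto simp: algebra_simps power_add)

lemma form_eq_0_at_0: "form d f \<Longrightarrow> d > 0 \<Longrightarrow> f 0 = 0"
  using form_homogeneous[of d f 0 0] by (simp add: power_0_left)

lemma form_0_const:
  assumes "form d f" and "d = 0"
  shows "f v = f w"
  using assms by (induction rule: form.induct) auto

section \<open>Forms as evaluations of homogeneous polynomials\<close>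

lemma mpol_eval_eq_sum:
  assumes "finite S" and "Poly_Mapping.keys f \<subseteq> S"
  shows "mpol_eval f v =
    (\<Sum>m\<in>S. Poly_Mapping.lookup f m * (\<Prod>i\<in>UNIV. (v $ i) ^ Poly_Mapping.lookup m i))"
  unfolding mpol_eval_def by (rule sum.mono_neutral_left) (use assms in \<open>auto simp: in_keys_iff\<close>)

lemma mpol_eval_zero [simp]: "mpol_eval 0 v = 0"
  by (simp add: mpol_eval_def)

lemma mpol_eval_add: "mpol_eval (f + g) v = mpol_eval f v + mpol_eval g v"
proof -
  let ?S = "Poly_Mapping.keys f \<union> Poly_Mapping.keys g"
  have "Poly_Mapping.keys (f + g) \<subseteq> ?S" by (rule Poly_Mapping.keys_add)
  then show ?thesis
    by (simp add: mpol_eval_eq_sum[of ?S] lookup_add algebra_simps sum.distrib)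
qed

lemma mpol_eval_sum: "mpol_eval (\<Sum>a\<in>I. f a) v = (\<Sum>a\<in>I. mpol_eval (f a) v)"
  by (induction I rule: infinite_finite_induct) (auto simp: mpol_eval_add)

lemma mpol_eval_single:
  "mpol_eval (Poly_Mapping.single m c) v = c * (\<Prod>i\<in>UNIV. (v $ i) ^ Poly_Mapping.lookup m i)"
  by (simp add: mpol_eval_def)

lemma mpol_eq_sum_single:
  "f = (\<Sum>m\<in>Poly_Mapping.keys f. Poly_Mapping.single m (Poly_Mapping.lookup f m))"
  by (rule poly_mapping_eqI)
    (auto simp: lookup_sum lookup_single when_def in_keys_iff)

lemma mpol_eval_mult: "mpol_eval (f * g) v = mpol_eval f v * mpol_eval g v"
proof -
  have single: "mpol_eval (Poly_Mapping.single m a * Poly_Mapping.single n b) v =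
      mpol_eval (Poly_Mapping.single m a) v * mpol_eval (Poly_Mapping.single n b) v" for m n a b
    by (simp add: mult_single mpol_eval_single lookup_add power_add prod.distrib)
  let ?s = "\<lambda>f m. Poly_Mapping.single m (Poly_Mapping.lookup f m)"
  have "mpol_eval (f * g) v =
      mpol_eval ((\<Sum>m\<in>Poly_Mapping.keys f. ?s f m) * (\<Sum>n\<in>Poly_Mapping.keys g. ?s g n)) v"
    using mpol_eq_sum_single[of f] mpol_eq_sum_single[of g] by simp
  also have "\<dots> = (\<Sum>m\<in>Poly_Mapping.keys f. mpol_eval (?s f m) v) *
      (\<Sum>n\<in>Poly_Mapping.keys g. mpol_eval (?s g n) v)"
    by (simp add: sum_product mpol_eval_sum single)
  also have "\<dots> = mpol_eval f v * mpol_eval g v"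
    using mpol_eq_sum_single[of f] mpol_eq_sum_single[of g] by (simp flip: mpol_eval_sum)
  finally show ?thesis .
qed

lemma homogeneous_zero: "homogeneous d 0"
  by (simp add: homogeneous_def)

lemma homogeneous_single:
  "(\<Sum>i\<in>UNIV. Poly_Mapping.lookup m i) = d \<Longrightarrow> homogeneous d (Poly_Mapping.single m c)"
  by (simp add: homogeneous_def)

lemma homogeneous_add: "homogeneous d f \<Longrightarrow> homogeneous d g \<Longrightarrow> homogeneous d (f + g)"
  using Poly_Mapping.keys_add[of f g] by (auto simp: homogeneous_def)

lemma homogeneous_mult:
  assumes "homogeneous d f" and "homogeneous e g"
  shows "homogeneous (d + e) (f * g)"
  unfolding homogeneous_def
proof
  fix m assume "m \<in> Poly_Mapping.keys (f * g)"
  then obtain a b where "m = a + b" "a \<in> Poly_Mapping.keys f" "b \<in> Poly_Mapping.keys g"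
    using Poly_Mapping.keys_mult[of f g] by blast
  then show "(\<Sum>i\<in>UNIV. Poly_Mapping.lookup m i) = d + e"
    using assms by (simp add: homogeneous_def lookup_add sum.distrib)
qed

lemma form_mpol_eval:
  assumes "homogeneous d f"
  shows "form d (mpol_eval f)"
proof -
  have "form d (\<lambda>v. Poly_Mapping.lookup f m * (\<Prod>i\<in>UNIV. (v $ i) ^ Poly_Mapping.lookup m i))"
    if "m \<in> Poly_Mapping.keys f" for m
  proof -
    have "form (\<Sum>i\<in>UNIV. Poly_Mapping.lookup m i * 1)
        (\<lambda>v. \<Prod>i\<in>UNIV. (v $ i) ^ Poly_Mapping.lookup m i)"
      by (intro form_prod form_power form_coord) auto
    then have "form d (\<lambda>v. \<Prod>i\<in>UNIV. (v $ i) ^ Poly_Mapping.lookup m i)"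
      using that assms by (simp add: homogeneous_def)
    then show ?thesis by (rule form_scale)
  qed
  then have "form d (\<lambda>v. mpol_eval f v)"
    unfolding mpol_eval_def by (rule form_sum)
  then show ?thesis by simp
qed

text \<open>The bridge between the library polynomials in the definitions and the inductive
  predicate used in the arguments.\<close>

lemma form_iff_mpol_eval: "form d f \<longleftrightarrow> (\<exists>g. homogeneous d g \<and> f = mpol_eval g)"
proof
  assume "form d f"
  then show "\<exists>g. homogeneous d g \<and> f = mpol_eval g"
  proof (induction rule: form.induct)
    case (form_zero d)
    show ?case by (intro exI[of _ 0]) (auto simp: homogeneous_zero)
  next
    case (form_const c)
    show ?case
      by (intro exI[of _ "Poly_Mapping.single 0 c"]) (auto simp: homogeneous_single mpol_eval_single)
  next
    case (form_coord i)
    have "(v $ j) ^ Poly_Mapping.lookup (Poly_Mapping.single i 1) j = (if j = i then v $ i else 1)"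
      for v :: "'a ^ 'b" and j
      by (simp add: lookup_single when_def)
    then show ?case
      by (intro exI[of _ "Poly_Mapping.single (Poly_Mapping.single i 1) 1"] conjI
          homogeneous_single) (auto simp: mpol_eval_single lookup_single when_def)
  next
    case form_add
    then show ?case using homogeneous_add mpol_eval_add by (metis (no_types))
  next
    case form_mult
    then show ?case using homogeneous_mult mpol_eval_mult by (metis (no_types))
  qed
qed (use form_mpol_eval in blast)

text \<open>Induction on the set \<open>A\<close> of variables. With the variable \<open>a\<close>
  free, the sum is a polynomial in one variable with infinitely many zeros; its coefficient at
  \<open>m a\<close> is a sum of the same kind over the exponents agreeing with \<open>m\<close> at
  \<open>a\<close>. Injectivity of restriction to \<open>A\<close> says that the monomials are
  distinct in the variables of \<open>A\<close>.\<close>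

lemma sum_monomials_eq_0_imp:
  fixes c :: "('n \<Rightarrow> nat) \<Rightarrow> 'k::alg_closed_field"
  assumes "finite A" and "finite K" and "inj_on (\<lambda>m. restrict m A) K"
    and "\<And>x. (\<Sum>m\<in>K. c m * (\<Prod>i\<in>A. x i ^ m i)) = 0" and "m \<in> K"
  shows "c m = 0"
  using assms
proof (induction A arbitrary: K m rule: finite_induct)
  case empty
  then have "K = {m}" by (auto simp: inj_on_def)
  then show ?case using empty(3) by simp
next
  case (insert a A)
  define L where "L = {n \<in> K. n a = m a}"
  have "finite L" "m \<in> L" using insert.prems by (auto simp: L_def)
  moreover have "inj_on (\<lambda>n. restrict n A) L"
  proof (rule inj_onI)
    fix n n' assume *: "n \<in> L" "n' \<in> L" "restrict n A = restrict n' A"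
    then have "restrict n (insert a A) = restrict n' (insert a A)"
      by (auto simp: L_def restrict_def fun_eq_iff) metis
    with * insert.prems(2) show "n = n'" unfolding inj_on_def L_def by blast
  qed
  moreover have "(\<Sum>n\<in>L. c n * (\<Prod>i\<in>A. x i ^ n i)) = 0" for x
  proof -
    define p where "p = (\<Sum>n\<in>K. monom (c n * (\<Prod>i\<in>A. x i ^ n i)) (n a))"
    have "poly p t = 0" for t
    proof -
      have "(\<Prod>i\<in>insert a A. ((x(a := t)) i) ^ n i) = t ^ n a * (\<Prod>i\<in>A. x i ^ n i)" for n
      proof -
        have "(\<Prod>i\<in>A. ((x(a := t)) i) ^ n i) = (\<Prod>i\<in>A. x i ^ n i)"
          using insert.hyps by (intro prod.cong) auto
        then show ?thesis using insert.hyps by simp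
      qed
      then show ?thesis
        using insert.prems(3)[of "x(a := t)"] by (simp add: p_def poly_sum poly_monom mult_ac)
    qed
    then have "p = 0" by (intro poly_0_if_cofinite_roots[of "{}"]) auto
    then have "coeff p (m a) = 0" by simp
    then have "(\<Sum>n\<in>K. if n a = m a then c n * (\<Prod>i\<in>A. x i ^ n i) else 0) = 0"
      by (simp add: p_def coeff_sum coeff_monom)
    then show ?thesis by (simp add: L_def sum.inter_filter insert.prems(1))
  qed
  ultimately show ?case using insert.IH[of L m] by blast
qed

lemma mpol_eval_nonzero:
  fixes f :: "('k::alg_closed_field, 'n::finite) mpol"
  assumes "f \<noteq> 0"
  shows "\<exists>v. mpol_eval f v \<noteq> 0"
proof (rule ccontr)
  assume "\<not> ?thesis"
  then have ev: "mpol_eval f v = 0" for v by simp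
  obtain m where m: "m \<in> Poly_Mapping.keys f" using assms by (metis keys_eq_empty ex_in_conv)
  let ?K = "Poly_Mapping.lookup ` Poly_Mapping.keys f"
  have inj: "inj_on Poly_Mapping.lookup (Poly_Mapping.keys f)"
    by (auto simp: inj_on_def)
  \<comment> \<open>Exponents are plain functions in the preceding lemma, so the coefficients of
    \<open>f\<close> are pulled back along \<open>Abs_poly_mapping\<close>.\<close>
  have "(Poly_Mapping.lookup f \<circ> Poly_Mapping.Abs_poly_mapping) (Poly_Mapping.lookup m) = 0"
  proof (rule sum_monomials_eq_0_imp[where A = UNIV and K = ?K])
    show "(\<Sum>n\<in>?K. (Poly_Mapping.lookup f \<circ> Poly_Mapping.Abs_poly_mapping) n *
        (\<Prod>i\<in>UNIV. x i ^ n i)) = 0" for x :: "'n \<Rightarrow> 'k"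
      using ev[of "\<chi> i. x i"] by (simp add: mpol_eval_def sum.reindex[OF inj] lookup_inverse)
  qed (use m in \<open>auto simp: inj_on_def restrict_def\<close>)
  then show False using m by (simp add: lookup_inverse in_keys_iff)
qed

section \<open>Restriction of forms to lines and curves\<close>

text \<open>Products are handled by the Cauchy product; the vanishing of \<open>a i\<close> beyond
  \<open>d\<close> is what \<open>polynomial_product\<close> asks for.\<close>

lemma form_taylor:
  assumes "form d f"
  shows "\<exists>a. (\<forall>i\<le>d. form (d - i) (a i)) \<and> (\<forall>i>d. a i = (\<lambda>_. 0)) \<and>
    (\<forall>q t. f (q + t *s e) = (\<Sum>i\<le>d. a i q * t ^ i))"
  using assms
proof (induction rule: form.induct)
  case (form_zero d)
  show ?case by (intro exI[of _ "\<lambda>_ _. 0"]) (auto intro: form.form_zero)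
next
  case (form_const c)
  show ?case by (intro exI[of _ "\<lambda>i _. if i = 0 then c else 0"]) (auto intro: form.form_const)
next
  case (form_coord j)
  let ?a = "\<lambda>i q. if i = 0 then q $ j else if i = 1 then e $ j else 0"
  have "form (1 - i) (?a i)" if "i \<le> 1" for i
  proof -
    from that have "i = 0 \<or> i = 1" by linarith
    then show ?thesis
      by (elim disjE) (simp_all add: form.form_coord[unfolded One_nat_def] form.form_const)
  qed
  then show ?case by (intro exI[of _ ?a]) auto
next
  case (form_add d f g)
  from form_add.IH(1) obtain a where "\<forall>i\<le>d. form (d - i) (a i)" "\<forall>i>d. a i = (\<lambda>_. 0)"
    "\<forall>q t. f (q + t *s e) = (\<Sum>i\<le>d. a i q * t ^ i)"
    by blast
  moreover from form_add.IH(2) obtain b where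
    "\<forall>i\<le>d. form (d - i) (b i)" "\<forall>i>d. b i = (\<lambda>_. 0)"
    "\<forall>q t. g (q + t *s e) = (\<Sum>i\<le>d. b i q * t ^ i)"
    by blast
  ultimately show ?case
    by (intro exI[of _ "\<lambda>i q. a i q + b i q"])
      (auto intro: form.form_add simp: algebra_simps sum.distrib)
next
  case (form_mult d f d' g)
  from form_mult.IH(1) obtain a where a: "\<forall>i\<le>d. form (d - i) (a i)" "\<forall>i>d. a i = (\<lambda>_. 0)"
    "\<forall>q t. f (q + t *s e) = (\<Sum>i\<le>d. a i q * t ^ i)"
    by blast
  from form_mult.IH(2) obtain b where b: "\<forall>i\<le>d'. form (d' - i) (b i)" "\<forall>i>d'. b i = (\<lambda>_. 0)"
    "\<forall>q t. g (q + t *s e) = (\<Sum>i\<le>d'. b i q * t ^ i)"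
    by blast
  define c where "c = (\<lambda>r q. \<Sum>k\<le>r. a k q * b (r - k) q)"
  have "form (d + d' - r) (c r)" for r
    unfolding c_def
  proof (rule form_sum)
    fix k assume "k \<in> {..r}"
    \<comment> \<open>The truncated differences of degrees add up correctly only in the last case;
      in the other two a factor is zero.\<close>
    consider "k > d" | "r - k > d'" | "k \<le> d" "r - k \<le> d'" by linarith
    then show "form (d + d' - r) (\<lambda>q. a k q * b (r - k) q)"
    proof cases
      case 3
      then show ?thesis
        using \<open>k \<in> {..r}\<close> a(1) b(1)
        by (intro form_mult'[where d = "d - k" and e = "d' - (r - k)"]) auto
    qed (auto simp: a(2) b(2) intro: form.form_zero)
  qed
  moreover have "c r = (\<lambda>_. 0)" if "r > d + d'" for r
  proof -
    have "a k q * b (r - k) q = 0" if "k \<le> r" for k q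
      using that \<open>r > d + d'\<close> a(2)[rule_format, of k] b(2)[rule_format, of "r - k"] by (cases "k > d") auto
    then show ?thesis unfolding c_def by (intro ext sum.neutral) blast
  qed
  moreover have "f (q + t *s e) * g (q + t *s e) = (\<Sum>r\<le>d + d'. c r q * t ^ r)" for q t
    unfolding a(3)[rule_format] b(3)[rule_format] c_def by (rule polynomial_product) (auto simp: a(2) b(2))
  ultimately show ?case by blast
qed

text \<open>The coefficient of \<open>t\<close> has degree 0, hence is constant, and
  \<open>q = 0\<close>, \<open>t = 1\<close> gives its value.\<close>

lemma linear_form_line:
  assumes "form 1 f"
  shows "f (q + t *s e) = f q + t * f e"
proof -
  obtain a where a: "form (1 - 1) (a 1)" "\<And>q t. f (q + t *s e) = (\<Sum>i\<le>1. a i q * t ^ i)"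
    using form_taylor[OF assms] by (metis le_refl)
  have "f (q + t *s e) = a 0 q + t * a 1 q" for q t
    unfolding a by (simp add: mult.commute)
  note * = this
  have "f q = a 0 q" for q using *[of q 0] by simp
  moreover have "f e = a 1 q"
    using *[of 0 1] form_0_const[OF a(1)] form_eq_0_at_0[OF assms] calculation by simp
  ultimately show ?thesis using *[of q t] by simp
qed

text \<open>The top coefficient is constant, with value found at \<open>q = 0\<close>,
  \<open>t = 1\<close>. The form \<open>b\<close> is the polar form of \<open>f\<close> against
  \<open>e\<close>, obtained without dividing by 2, so characteristic 2 is included.\<close>

lemma quadratic_form_line:
  assumes "form 2 f"
  shows "\<exists>b. form 1 b \<and> (\<forall>q t. f (q + t *s e) = f q + t * b q + t\<^sup>2 * f e)"
proof -
  obtain a where a: "\<And>i. i \<le> 2 \<Longrightarrow> form (2 - i) (a i)"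
    "\<And>q t. f (q + t *s e) = (\<Sum>i\<le>2. a i q * t ^ i)"
    using form_taylor[OF assms] by metis
  have *: "f (q + t *s e) = a 0 q + t * a 1 q + t\<^sup>2 * a 2 q" for q t
    unfolding a by (simp add: numeral_2_eq_2 algebra_simps)
  have 0: "f q = a 0 q" for q using *[of q 0] by simp
  have 1: "form 1 (a 1)" using a(1)[of 1] by simp
  have "a 2 q = f e" for q
    using *[of 0 1] form_0_const[OF a(1)[of 2], of q 0] form_eq_0_at_0[OF assms]
      form_eq_0_at_0[OF 1] 0 by simp
  then show ?thesis using 0 1 * by auto
qed

text \<open>Curves of coordinate vectors rather than of projective points; they may pass through
  0.\<close>

definition polynomial_curve :: "('k::field \<Rightarrow> 'k ^ 'n::finite) \<Rightarrow> bool" where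
  "polynomial_curve c \<longleftrightarrow> (\<forall>i. \<exists>p. \<forall>t. c t $ i = poly p t)"

lemma form_on_polynomial_curve:
  assumes "form d f" and "polynomial_curve c"
  shows "\<exists>p. \<forall>t. f (c t) = poly p t"
  using assms
proof (induction rule: form.induct)
  case (form_zero d)
  show ?case by (intro exI[of _ 0]) auto
next
  case (form_const a)
  show ?case by (intro exI[of _ "[:a:]"]) auto
next
  case form_coord
  then show ?case by (simp add: polynomial_curve_def)
next
  case form_add
  then show ?case by (metis poly_add)
next
  case form_mult
  then show ?case by (metis poly_mult)
qed

lemma polynomial_curve_line: "polynomial_curve (\<lambda>t. q + t *s r)"
  unfolding polynomial_curve_def
proof
  fix i
  show "\<exists>p. \<forall>t. (q + t *s r) $ i = poly p t" by (intro exI[of _ "[:q $ i, r $ i:]"]) auto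
qed

lemma form_finite_zeros_on_curve:
  fixes c :: "'k::alg_closed_field \<Rightarrow> 'k ^ 'n::finite"
  assumes "form d f" and "polynomial_curve c" and "f (c t0) \<noteq> 0"
  shows "finite {t. f (c t) = 0}"
proof -
  obtain p where p: "\<And>t. f (c t) = poly p t"
    using form_on_polynomial_curve[OF assms(1,2)] by metis
  then have "p \<noteq> 0" using assms(3) by force
  then show ?thesis using poly_roots_finite[of p] by (simp add: p)
qed

text \<open>On the line through \<open>a\<close> and \<open>b\<close> each form has only finitely
  many zeros.\<close>

lemma forms_common_nonzero:
  fixes f g :: "'k::alg_closed_field ^ 'n::finite \<Rightarrow> 'k"
  assumes "form d f" and "form e g" and "f a \<noteq> 0" and "g b \<noteq> 0"
  shows "\<exists>q. f q \<noteq> 0 \<and> g q \<noteq> 0"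
proof -
  define r where "r = b - a"
  have "a + r = b" by (simp add: r_def)
  let ?c = "\<lambda>t. a + t *s r"
  have "finite {t. f (?c t) = 0}" "finite {t. g (?c t) = 0}"
    using form_finite_zeros_on_curve[OF assms(1) polynomial_curve_line, of a 0]
      form_finite_zeros_on_curve[OF assms(2) polynomial_curve_line, of a 1 r] assms \<open>a + r = b\<close>
    by auto
  then have "\<exists>t. t \<notin> {t. f (?c t) = 0} \<union> {t. g (?c t) = 0}"
    using ex_new_if_finite[OF infinite_UNIV_alg_closed] finite_UnI by blast
  then show ?thesis by blast
qed

text \<open>Either \<open>b\<close> itself is a zero, or \<open>f (a + t b)\<close> is a polynomial
  in \<open>t\<close> of exact degree \<open>d\<close> with leading coefficient \<open>f b\<close>,
  and so has a root.\<close>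

lemma form_zero_on_pencil:
  fixes f :: "'k::alg_closed_field ^ 'n::finite \<Rightarrow> 'k"
  assumes "form d f" and "d > 0"
  shows "\<exists>s t. (s \<noteq> 0 \<or> t \<noteq> 0) \<and> f (s *s a + t *s b) = 0"
proof (cases "f b = 0")
  case True
  then show ?thesis by (intro exI[of _ 0] exI[of _ 1]) auto
next
  case False
  obtain c where c: "\<And>i. i \<le> d \<Longrightarrow> form (d - i) (c i)"
    "\<And>q t. f (q + t *s b) = (\<Sum>i\<le>d. c i q * t ^ i)"
    using form_taylor[OF assms(1)] by metis
  have "c i 0 = 0" if "i < d" for i
    using form_eq_0_at_0[OF c(1)[of i]] that by simp
  then have "(\<Sum>i\<le>d. c i 0) = (\<Sum>i\<in>{d}. c i 0)"
    by (intro sum.mono_neutral_right) auto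
  then have "f b = c d 0" using c(2)[of 0 1] by simp
  then have "c d a \<noteq> 0" using False form_0_const[OF c(1)[of d], of a 0] by simp
  then obtain t where "(\<Sum>i\<le>d. c i a * t ^ i) = 0"
    using alg_closed[of d "\<lambda>i. c i a"] assms(2) by blast
  then show ?thesis using c(2)[of a t] by (intro exI[of _ 1] exI[of _ t]) auto
qed

section \<open>Expansion of a cubic form at a singular point\<close>

text \<open>Compare the expansions of \<open>f (q + (t + 1) e)\<close> about \<open>q\<close> and
  about \<open>q + t e\<close>.\<close>

lemma line_coefficient_invariant:
  fixes f Q :: "'k::field ^ 'n::finite \<Rightarrow> 'k"
  assumes "\<And>q t. f (q + t *s e) = f q + t * Q q"
  shows "Q (q + t *s e) = Q q"
proof -
  have "q + (t + 1) *s e = (q + t *s e) + 1 *s e" by (simp add: vec_eq_iff algebra_simps)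
  then have "f q + (t + 1) * Q q = f q + t * Q q + 1 * Q (q + t *s e)" by (metis assms)
  then show ?thesis by (simp add: algebra_simps)
qed

text \<open>The chain rule at \<open>s = 0\<close>, which turns the formal derivatives of the
  Jacobian criterion into a coefficient of the restriction to a line.\<close>

lemma mpol_eval_line_pderiv:
  fixes f :: "('k::field, 'n::finite) mpol"
  shows "\<exists>p. (\<forall>s. mpol_eval f (e + s *s q) = poly p s) \<and>
    poly (pderiv p) 0 = (\<Sum>i\<in>UNIV. q $ i * mpol_eval (partial_deriv i f) e)"
proof -
  define P where "P m = (\<Prod>j\<in>UNIV. [:e $ j, q $ j:] ^ Poly_Mapping.lookup m j)"
    for m :: "'n \<Rightarrow>\<^sub>0 nat"
  define p where "p = (\<Sum>m\<in>Poly_Mapping.keys f. smult (Poly_Mapping.lookup f m) (P m))"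
  have line: "mpol_eval f (e + s *s q) = poly p s" for s
    by (simp add: mpol_eval_def p_def P_def poly_sum poly_prod)
  have pderiv_sum: "pderiv (\<Sum>m\<in>K. f m) = (\<Sum>m\<in>K. pderiv (f m))"
    for K :: "('n \<Rightarrow>\<^sub>0 nat) set" and f :: "_ \<Rightarrow> 'k poly"
    by (induction K rule: infinite_finite_induct) (auto simp: pderiv_add)
  have dP: "poly (pderiv (P m)) 0 = (\<Sum>i\<in>UNIV. q $ i * (of_nat (Poly_Mapping.lookup m i) *
      (\<Prod>j\<in>UNIV. (e $ j) ^ Poly_Mapping.lookup (m - Poly_Mapping.single i 1) j)))" for m
  proof -
    \<comment> \<open>Isolating the factor at \<open>i\<close> gives the shape of the product rule;
      with truncated subtraction this is also correct for exponent 0.\<close>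
    have "(\<Prod>j\<in>UNIV. (e $ j) ^ Poly_Mapping.lookup (m - Poly_Mapping.single i 1) j) =
        (\<Prod>j\<in>UNIV - {i}. (e $ j) ^ Poly_Mapping.lookup m j) * (e $ i) ^ (Poly_Mapping.lookup m i - 1)"
      for i
      by (subst prod.remove[of _ i]) (auto simp: lookup_minus lookup_single intro!: prod.cong)
    then show ?thesis
      by (simp add: P_def pderiv_prod pderiv_power pderiv_pCons poly_sum poly_prod mult_ac)
  qed
  have "poly (pderiv p) 0 = (\<Sum>i\<in>UNIV. q $ i * mpol_eval (partial_deriv i f) e)"
    unfolding partial_deriv_def mpol_eval_sum mpol_eval_single p_def pderiv_sum pderiv_smult
      poly_sum poly_smult dP sum_distrib_left
    by (subst sum.swap) (simp add: mult_ac)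
  then show ?thesis using line by blast
qed

text \<open>In the expansion in \<open>t\<close>, the coefficient of \<open>t ^ 3\<close> is the
  value of \<open>F\<close> at \<open>e\<close> and that of \<open>t\<^sup>2\<close> is the
  differential of \<open>F\<close> at \<open>e\<close> applied to \<open>q\<close>. Both vanish at a
  singular point.\<close>

lemma cubic_form_line_singular:
  fixes F :: "('k::alg_closed_field, 'n::finite) mpol"
  assumes "homogeneous 3 F" and "mpol_eval F e = 0"
    and "\<And>i. mpol_eval (partial_deriv i F) e = 0"
  shows "\<exists>Q. form 2 Q \<and> (\<forall>q t. mpol_eval F (q + t *s e) = mpol_eval F q + t * Q q)"
proof -
  have F: "form 3 (mpol_eval F)" using assms(1) by (rule form_mpol_eval)
  obtain a where a: "\<And>i. i \<le> 3 \<Longrightarrow> form (3 - i) (a i)"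
    "\<And>q t. mpol_eval F (q + t *s e) = (\<Sum>i\<le>3. a i q * t ^ i)"
    using form_taylor[OF F] by metis
  have *: "mpol_eval F (q + t *s e) = a 0 q + t * a 1 q + t\<^sup>2 * a 2 q + t ^ 3 * a 3 q" for q t
    unfolding a by (simp add: numeral_3_eq_3 numeral_2_eq_2 algebra_simps)
  have 0: "mpol_eval F q = a 0 q" for q using *[of q 0] by simp
  have 3: "a 3 q = 0" for q
    using *[of 0 1] form_0_const[OF a(1)[of 3], of q 0] form_eq_0_at_0[OF a(1)] assms(2) by simp
  have 2: "a 2 q = 0" for q
  proof -
    obtain p where p: "\<And>s. mpol_eval F (e + s *s q) = poly p s"
      "poly (pderiv p) 0 = (\<Sum>i\<in>UNIV. q $ i * mpol_eval (partial_deriv i F) e)"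
      using mpol_eval_line_pderiv by metis
    \<comment> \<open>Homogeneity gives \<open>F (e + s q) = s ^ 3 F (q + e / s)\<close>, which
      reverses the order of the coefficients: \<open>a 2 q\<close> becomes the coefficient of
      \<open>s\<close>.\<close>
    have "p = [:0, a 2 q, a 1 q, a 0 q:]"
    proof (rule poly_eq_if_cofinite_eq[of "{0}"])
      fix s :: 'k assume "s \<notin> {0}"
      then have "e + s *s q = s *s (q + inverse s *s e)"
        by (simp add: vec_eq_iff algebra_simps)
      then have "poly p s = s ^ 3 * mpol_eval F (q + inverse s *s e)"
        using form_homogeneous[OF F] p(1) by metis
      also have "\<dots> = poly [:0, a 2 q, a 1 q, a 0 q:] s"
        unfolding * using \<open>s \<notin> {0}\<close> by (simp add: 3 field_simps power3_eq_cube power2_eq_square)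
      finally show "poly p s = poly [:0, a 2 q, a 1 q, a 0 q:] s" .
    qed simp
    then show ?thesis using p(2) assms(3) by (simp add: pderiv_pCons)
  qed
  have "form 2 (a 1)" using a(1)[of 1] by simp
  moreover have "mpol_eval F (q + t *s e) = mpol_eval F q + t * a 1 q" for q t
    using *[of q t] by (simp add: 0 2 3)
  ultimately show ?thesis by blast
qed

section \<open>Forms depending on a parameter\<close>

text \<open>Polynomials in the parameter \<open>s\<close> whose coefficients are forms of degree
  \<open>d\<close> in \<open>q\<close>. The parameter has weight 0 because a function of degree 0
  will be substituted for it.\<close>

inductive parametric_form :: "nat \<Rightarrow> ('k::field \<Rightarrow> 'k ^ 'n::finite \<Rightarrow> 'k) \<Rightarrow> bool" where
  param: "parametric_form 0 (\<lambda>s q. s)"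
| form: "form d f \<Longrightarrow> parametric_form d (\<lambda>s. f)"
| add: "parametric_form d f \<Longrightarrow> parametric_form d g \<Longrightarrow> parametric_form d (\<lambda>s q. f s q + g s q)"
| mult: "parametric_form d f \<Longrightarrow> parametric_form e g \<Longrightarrow> parametric_form (d + e) (\<lambda>s q. f s q * g s q)"

lemma parametric_form_mult':
  "parametric_form d f \<Longrightarrow> parametric_form e g \<Longrightarrow> n = d + e \<Longrightarrow> parametric_form n (\<lambda>s q. f s q * g s q)"
  using parametric_form.mult by blast

lemma parametric_form_const_mult:
  assumes "parametric_form d f"
  shows "parametric_form d (\<lambda>s q. c * f s q)"
  by (rule parametric_form_mult'[OF parametric_form.form[OF form_const] assms]) simp

lemma parametric_form_diff:
  assumes "parametric_form d f" and "parametric_form d g"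
  shows "parametric_form d (\<lambda>s q. f s q - g s q)"
  using parametric_form.add[OF assms(1) parametric_form_const_mult[OF assms(2), of "-1"]] by simp

lemma parametric_form_poly:
  assumes "parametric_form d f"
  shows "\<exists>p. \<forall>s. f s q = poly p s"
  using assms
proof (induction rule: parametric_form.induct)
  case param
  show ?case by (intro exI[of _ "[:0, 1:]"]) auto
next
  case (form d f)
  show ?case by (intro exI[of _ "[:f q:]"]) auto
next
  case add
  then show ?case by (metis poly_add)
next
  case mult
  then show ?case by (metis poly_mult)
qed

text \<open>The product rule for difference quotients makes divisibility by the parameter inductive.\<close>

lemma parametric_form_difference_quotient:
  assumes "form d f" and \<rho>: "\<And>i. parametric_form 1 (\<lambda>s q. \<rho> s q $ i)"
    and D: "\<And>i. parametric_form 1 (\<lambda>s q. D s q $ i)"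
    and \<rho>_eq: "\<And>s q. \<rho> s q = q + s *s D s q"
  shows "parametric_form d (\<lambda>s q. f (\<rho> s q)) \<and>
    (\<exists>E. parametric_form d E \<and> (\<forall>s q. f (\<rho> s q) = f q + s * E s q))"
  using assms(1)
proof (induction rule: form.induct)
  case (form_zero d)
  show ?case
    by (auto intro!: exI[of _ "\<lambda>_ _. 0"] parametric_form.form form.form_zero)
next
  case (form_const c)
  show ?case
    by (auto intro!: exI[of _ "\<lambda>_ _. 0"] parametric_form.form form.form_zero form.form_const)
next
  case (form_coord i)
  show ?case using \<rho>[of i] D[of i] \<rho>_eq by auto
next
  case (form_add d f g)
  then obtain E E' where E: "parametric_form d E" "\<forall>s q. f (\<rho> s q) = f q + s * E s q"
    "parametric_form d E'" "\<forall>s q. g (\<rho> s q) = g q + s * E' s q" by blast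
  have 1: "parametric_form d (\<lambda>s q. f (\<rho> s q) + g (\<rho> s q))"
    using form_add.IH by (intro parametric_form.add) auto
  have 2: "parametric_form d (\<lambda>s q. E s q + E' s q)"
    using E by (intro parametric_form.add) auto
  have "f (\<rho> s q) + g (\<rho> s q) = f q + g q + s * (E s q + E' s q)" for s q
    using E(2,4) by (simp add: algebra_simps)
  with 1 2 show ?case by blast
next
  case (form_mult d f e g)
  then obtain E E' where E: "parametric_form d E" "\<forall>s q. f (\<rho> s q) = f q + s * E s q"
    "parametric_form e E'" "\<forall>s q. g (\<rho> s q) = g q + s * E' s q" by blast
  have 1: "parametric_form (d + e) (\<lambda>s q. f (\<rho> s q) * g (\<rho> s q))"
    using form_mult.IH by (intro parametric_form.mult) auto
  have 2: "parametric_form (d + e) (\<lambda>s q. E s q * g (\<rho> s q) + f q * E' s q)"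
    using form_mult E by (intro parametric_form.add parametric_form.mult parametric_form.form) auto
  have "f (\<rho> s q) * g (\<rho> s q) = f q * g q + s * (E s q * g (\<rho> s q) + f q * E' s q)" for s q
    using E(2,4) by (simp add: algebra_simps)
  with 1 2 show ?case by blast
qed

text \<open>The degrees presuppose that \<open>F\<close> is a cubic form, so that \<open>f\<close> has degree \<open>d\<close> off \<open>F = 0\<close>.\<close>

definition localized_form :: "(('k::field) ^ ('n::finite) \<Rightarrow> 'k) \<Rightarrow> nat \<Rightarrow> ('k ^ 'n \<Rightarrow> 'k) \<Rightarrow> bool" where
  "localized_form F d f \<longleftrightarrow> (\<exists>N. \<forall>n\<ge>N. \<exists>h. form (d + 3 * n) h \<and> (\<forall>q. F q \<noteq> 0 \<longrightarrow> F q ^ n * f q = h q))"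

text \<open>Since \<open>localized_form\<close> speaks of all large exponents \<open>n\<close>, the
  two summands can be brought to the same power of \<open>F\<close>.\<close>

lemma localized_form_add:
  assumes "localized_form F d f" and "localized_form F d g"
  shows "localized_form F d (\<lambda>q. f q + g q)"
proof -
  obtain N M where N: "\<And>n. n \<ge> N \<Longrightarrow> \<exists>h. form (d + 3 * n) h \<and> (\<forall>q. F q \<noteq> 0 \<longrightarrow> F q ^ n * f q = h q)"
    and M: "\<And>n. n \<ge> M \<Longrightarrow> \<exists>h. form (d + 3 * n) h \<and> (\<forall>q. F q \<noteq> 0 \<longrightarrow> F q ^ n * g q = h q)"
    using assms by (auto simp: localized_form_def)
  have "\<exists>h. form (d + 3 * n) h \<and> (\<forall>q. F q \<noteq> 0 \<longrightarrow> F q ^ n * (f q + g q) = h q)"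
    if "n \<ge> N + M" for n
  proof -
    from N[of n] that obtain h
      where "form (d + 3 * n) h" "\<forall>q. F q \<noteq> 0 \<longrightarrow> F q ^ n * f q = h q" by auto
    moreover from M[of n] that obtain h'
      where "form (d + 3 * n) h'" "\<forall>q. F q \<noteq> 0 \<longrightarrow> F q ^ n * g q = h' q" by auto
    ultimately show ?thesis
      by (intro exI[of _ "\<lambda>q. h q + h' q"]) (auto intro: form_add simp: algebra_simps)
  qed
  then show ?thesis unfolding localized_form_def by blast
qed

lemma localized_form_mult:
  assumes "localized_form F d f" and "localized_form F e g"
  shows "localized_form F (d + e) (\<lambda>q. f q * g q)"
proof -
  obtain N M where N: "\<And>n. n \<ge> N \<Longrightarrow> \<exists>h. form (d + 3 * n) h \<and> (\<forall>q. F q \<noteq> 0 \<longrightarrow> F q ^ n * f q = h q)"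
    and M: "\<And>n. n \<ge> M \<Longrightarrow> \<exists>h. form (e + 3 * n) h \<and> (\<forall>q. F q \<noteq> 0 \<longrightarrow> F q ^ n * g q = h q)"
    using assms by (auto simp: localized_form_def)
  have "\<exists>h. form (d + e + 3 * n) h \<and> (\<forall>q. F q \<noteq> 0 \<longrightarrow> F q ^ n * (f q * g q) = h q)"
    if "n \<ge> N + M" for n
  proof -
    from N[of N] obtain h
      where h: "form (d + 3 * N) h" "\<forall>q. F q \<noteq> 0 \<longrightarrow> F q ^ N * f q = h q" by blast
    from that have "M \<le> n - N" by linarith
    from M[OF this] obtain h' where h': "form (e + 3 * (n - N)) h'"
      "\<forall>q. F q \<noteq> 0 \<longrightarrow> F q ^ (n - N) * g q = h' q" by blast
    have "F q ^ n * (f q * g q) = h q * h' q" if "F q \<noteq> 0" for q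
    proof -
      have "F q ^ n = F q ^ N * F q ^ (n - N)"
        using \<open>n \<ge> N + M\<close> by (simp flip: power_add)
      moreover have "F q ^ N * f q = h q" "F q ^ (n - N) * g q = h' q" using h h' that by auto
      ultimately show ?thesis by (metis mult.assoc mult.left_commute)
    qed
    moreover have "form (d + e + 3 * n) (\<lambda>q. h q * h' q)"
      by (rule form_mult'[OF h(1) h'(1)]) (use that in auto)
    ultimately show ?thesis by blast
  qed
  then show ?thesis unfolding localized_form_def by blast
qed

lemma localized_form_divide:
  assumes "localized_form F (d + 3) f"
  shows "localized_form F d (\<lambda>q. f q / F q)"
proof -
  obtain N where N: "\<And>n. n \<ge> N \<Longrightarrow>
      \<exists>h. form (d + 3 + 3 * n) h \<and> (\<forall>q. F q \<noteq> 0 \<longrightarrow> F q ^ n * f q = h q)"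
    using assms by (auto simp: localized_form_def)
  have "\<exists>h. form (d + 3 * n) h \<and> (\<forall>q. F q \<noteq> 0 \<longrightarrow> F q ^ n * (f q / F q) = h q)"
    if "n \<ge> Suc N" for n
  proof -
    from that obtain m where m: "n = Suc m" "m \<ge> N" by (cases n) auto
    have "d + 3 + 3 * m = d + 3 * n" using m(1) by simp
    with N[OF m(2)] obtain h
      where "form (d + 3 * n) h" "\<forall>q. F q \<noteq> 0 \<longrightarrow> F q ^ m * f q = h q" by metis
    then show ?thesis using m(1) by auto
  qed
  then show ?thesis unfolding localized_form_def by blast
qed

lemma localized_form_form:
  assumes "form 3 F" and "form d f"
  shows "localized_form F d f"
  unfolding localized_form_def
proof (intro exI allI impI conjI)
  fix n :: nat
  show "form (d + 3 * n) (\<lambda>q. F q ^ n * f q)"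
    by (rule form_mult'[OF form_power[OF assms(1)] assms(2)]) simp
qed simp

text \<open>This is how \<open>s = l Q / F\<close>, of degree 0, enters the construction.\<close>

lemma localized_form_parametric:
  assumes "parametric_form d f" and "form 3 F" and "localized_form F 0 u"
  shows "localized_form F d (\<lambda>q. f (u q) q)"
  using assms(1)
  by (induction rule: parametric_form.induct)
    (use assms(2,3) in \<open>auto intro: localized_form_add localized_form_mult localized_form_form\<close>)

text \<open>One power of \<open>F\<close> clears the denominators of all coordinates, and
  multiplying by it does not move the projective point. The sum of the exponents \<open>N i\<close>
  serves as a common bound.\<close>

lemma localized_vector:
  fixes \<theta> :: "'k::field ^ 'n::finite \<Rightarrow> 'k ^ 'n"
  assumes "\<And>i. localized_form F 1 (\<lambda>q. \<theta> q $ i)"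
  shows "\<exists>n G. (\<forall>i. form (1 + 3 * n) (\<lambda>q. G q $ i)) \<and> (\<forall>q. F q \<noteq> 0 \<longrightarrow> G q = F q ^ n *s \<theta> q)"
proof -
  obtain N where N: "\<And>i n. n \<ge> N i \<Longrightarrow>
      \<exists>h. form (1 + 3 * n) h \<and> (\<forall>q. F q \<noteq> 0 \<longrightarrow> F q ^ n * \<theta> q $ i = h q)"
    using assms unfolding localized_form_def by metis
  define n where "n = (\<Sum>i\<in>UNIV. N i)"
  have "N i \<le> n" for i unfolding n_def by (rule member_le_sum) auto
  then have "\<forall>i. \<exists>h. form (1 + 3 * n) h \<and> (\<forall>q. F q \<noteq> 0 \<longrightarrow> F q ^ n * \<theta> q $ i = h q)"
    using N by blast
  from choice[OF this] obtain h where
    "\<forall>i. form (1 + 3 * n) (h i) \<and> (\<forall>q. F q \<noteq> 0 \<longrightarrow> F q ^ n * \<theta> q $ i = h i q)" ..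
  then show ?thesis
    by (intro exI[of _ n] exI[of _ "\<lambda>q. \<chi> i. h i q"]) (auto simp: vec_eq_iff)
qed

section \<open>Projective space\<close>

lemma abs_proj_eq_iff:
  assumes "v \<noteq> 0" and "w \<noteq> 0"
  shows "abs_proj v = abs_proj w \<longleftrightarrow> (\<exists>c. c \<noteq> 0 \<and> w = c *s v)"
proof -
  have "proj_rel u u" if "u \<noteq> 0" for u :: "'a ^ 'b"
    using that by (auto simp: proj_rel_def intro!: exI[of _ 1])
  then have "abs_proj v = abs_proj w \<longleftrightarrow> proj_rel v w"
    using Quotient3_rel[OF Quotient3_proj, of v w] assms by blast
  then show ?thesis using assms by (simp add: proj_rel_def)
qed

lemma abs_proj_scale:
  assumes "v \<noteq> 0" and "c \<noteq> 0"
  shows "abs_proj (c *s v) = abs_proj v"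
proof -
  have "c *s v \<noteq> 0" using assms by simp
  then have "abs_proj v = abs_proj (c *s v)" using abs_proj_eq_iff[OF assms(1)] assms(2) by blast
  then show ?thesis by simp
qed

lemma proj_exhaust:
  obtains v where "v \<noteq> 0" and "p = abs_proj v"
  by (induction p rule: proj.abs_induct) (auto simp: proj_rel_def)

lemma mem_hom_coords_abs_proj:
  assumes "v \<noteq> 0"
  shows "w \<in> hom_coords (abs_proj v) \<longleftrightarrow> (\<exists>c. c \<noteq> 0 \<and> w = c *s v)"
  using abs_proj_eq_iff[OF assms, of w] assms
  by (auto simp: hom_coords_def)

lemma mem_zero_locus_abs_proj:
  assumes "homogeneous d f" and "v \<noteq> 0"
  shows "abs_proj v \<in> zero_locus f \<longleftrightarrow> mpol_eval f v = 0"
proof -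
  have "mpol_eval f (c *s v) = c ^ d * mpol_eval f v" for c
    by (rule form_homogeneous[OF form_mpol_eval[OF assms(1)]])
  then show ?thesis
    unfolding zero_locus_def mem_Collect_eq Ball_def mem_hom_coords_abs_proj[OF assms(2)]
    by (auto intro: exI[of _ 1])
qed

lemma openin_zariski_nonzero:
  assumes "form d f"
  shows "\<exists>U. openin zariski U \<and> (\<forall>v. v \<noteq> 0 \<longrightarrow> abs_proj v \<in> U \<longleftrightarrow> f v \<noteq> 0)"
proof -
  obtain g where g: "homogeneous d g" "f = mpol_eval g" using assms form_iff_mpol_eval by blast
  then have "openin zariski (- zero_locus g)"
    unfolding zariski_def by (intro topology_generated_by_Basis) blast
  then show ?thesis using g by (auto simp: mem_zero_locus_abs_proj)
qed

lemma topspace_zariski [simp]: "topspace zariski = UNIV"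
proof -
  obtain U :: "('a, 'b) proj set" where "openin zariski U" "\<forall>v. v \<noteq> 0 \<longrightarrow> abs_proj v \<in> U"
    using openin_zariski_nonzero[OF form_const[of 1]] by auto
  then have "U = UNIV" by (metis UNIV_eq_I proj_exhaust)
  then show ?thesis using \<open>openin zariski U\<close> openin_subset by blast
qed

text \<open>Induction on the generation of the open set: basic sets reduce to the zeros of a form on
  the curve, intersections unite the exceptional sets, and for unions one member containing the
  point at parameter 0 suffices.\<close>

lemma finite_curve_outside_open:
  fixes c :: "'k::alg_closed_field \<Rightarrow> 'k ^ 'n::finite"
  assumes "openin zariski U" and "polynomial_curve c" and "c 0 \<noteq> 0" and "abs_proj (c 0) \<in> U"
  shows "finite {t. c t = 0 \<or> abs_proj (c t) \<notin> U}"
proof -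
  obtain i where i: "c 0 $ i \<noteq> 0" using assms(3) by (auto simp: vec_eq_iff)
  have "finite {t. c t $ i = 0}"
    using form_finite_zeros_on_curve[OF form_coord assms(2) i] .
  then have fin0: "finite {t. c t = 0}" by (rule rev_finite_subset) auto
  have "generate_topology_on {- zero_locus f | f d. homogeneous d f} U"
    using assms(1) by (simp add: zariski_def openin_topology_generated_by_iff)
  then have "finite {t. c t \<noteq> 0 \<and> abs_proj (c t) \<notin> U}"
    using assms(4)
  proof (induction rule: generate_topology_on.induct)
    case (Int A B)
    then have "finite ({t. c t \<noteq> 0 \<and> abs_proj (c t) \<notin> A} \<union> {t. c t \<noteq> 0 \<and> abs_proj (c t) \<notin> B})"
      by simp
    then show ?case by (rule rev_finite_subset) auto
  next
    case (UN K)
    then obtain A where "A \<in> K" "abs_proj (c 0) \<in> A" by blast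
    then have "finite {t. c t \<noteq> 0 \<and> abs_proj (c t) \<notin> A}" using UN by blast
    then show ?case by (rule rev_finite_subset) (use \<open>A \<in> K\<close> in auto)
  next
    case (Basis A)
    then obtain f d where f: "A = - zero_locus f" "homogeneous d f" by blast
    then have "mpol_eval f (c 0) \<noteq> 0"
      using Basis(2) assms(3) by (simp add: mem_zero_locus_abs_proj)
    then have "finite {t. mpol_eval f (c t) = 0}"
      using form_finite_zeros_on_curve[OF form_mpol_eval[OF f(2)] assms(2)] by blast
    then show ?case
      by (rule rev_finite_subset) (use f mem_zero_locus_abs_proj[OF f(2)] in auto)
  qed simp
  with fin0 have "finite ({t. c t = 0} \<union> {t. c t \<noteq> 0 \<and> abs_proj (c t) \<notin> U})" by simp
  then show ?thesis by (rule rev_finite_subset) auto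
qed

section \<open>Morphisms and automorphisms\<close>

lemma regular_onE:
  assumes "regular_on V f" and "p \<in> V"
  obtains W d g h where "openin (subtopology zariski V) W" "p \<in> W" "homogeneous d g" "homogeneous d h"
    "\<forall>q\<in>W. \<forall>v\<in>hom_coords q. mpol_eval h v \<noteq> 0 \<and> f q = mpol_eval g v / mpol_eval h v"
proof -
  from assms have "\<exists>W d g h. openin (subtopology zariski V) W \<and> p \<in> W \<and>
      homogeneous d g \<and> homogeneous d h \<and> (\<forall>q\<in>W. \<forall>v\<in>hom_coords q.
        mpol_eval h v \<noteq> 0 \<and> f q = mpol_eval g v / mpol_eval h v)"
    unfolding regular_on_def by (rule bspec)
  then show thesis by (elim exE conjE) (rule that)
qed

text \<open>Composition with \<open>G\<close> turns forms of degree \<open>d\<close> into forms of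
  degree \<open>d * N\<close>, so preimages of basic open sets and pullbacks of quotients of forms
  keep their shape.\<close>

lemma morphism_onI_forms:
  fixes G :: "'k::field ^ 'n::finite \<Rightarrow> 'k ^ 'm::finite"
  assumes G: "\<And>i. form N (\<lambda>v. G v $ i)"
    and maps: "\<And>v. v \<noteq> 0 \<Longrightarrow> abs_proj v \<in> Y \<Longrightarrow>
      G v \<noteq> 0 \<and> \<phi> (abs_proj v) = abs_proj (G v) \<and> abs_proj (G v) \<in> Z"
  shows "morphism_on Y Z \<phi>"
proof -
  have comp: "\<exists>g'. homogeneous (d * N) g' \<and> (\<forall>v. mpol_eval g' v = mpol_eval g (G v))"
    if "homogeneous d g" for d and g :: "('k, 'm) mpol"
    using form_compose[OF form_mpol_eval[OF that] G] form_iff_mpol_eval by metis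
  have into: "\<phi> p \<in> Z" if "p \<in> Y" for p
    using that maps by (cases p rule: proj_exhaust) auto
  have "continuous_map (subtopology zariski Y) zariski \<phi>"
    unfolding zariski_def continuous_on_generated_topo_iff
  proof (intro conjI allI impI)
    fix U :: "('k, 'm) proj set" assume "U \<in> {- zero_locus f | f d. homogeneous d f}"
    then obtain f d where f: "U = - zero_locus f" "homogeneous d f" by blast
    obtain g where g: "homogeneous (d * N) g" "\<And>v. mpol_eval g v = mpol_eval f (G v)"
      using comp[OF f(2)] by blast
    have "\<phi> -` U \<inter> Y = - zero_locus g \<inter> Y"
    proof (rule set_eqI)
      fix p :: "('k, 'n) proj"
      obtain v where "v \<noteq> 0" "p = abs_proj v" by (rule proj_exhaust)
      then show "p \<in> \<phi> -` U \<inter> Y \<longleftrightarrow> p \<in> - zero_locus g \<inter> Y"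
        using maps[of v] f g by (auto simp: mem_zero_locus_abs_proj)
    qed
    moreover have "openin zariski (- zero_locus g)"
      unfolding zariski_def using g(1) by (intro topology_generated_by_Basis) blast
    ultimately show "openin (subtopology (topology_generated_by {- zero_locus f | f d. homogeneous d f}) Y)
        (\<phi> -` U \<inter> topspace (subtopology (topology_generated_by {- zero_locus f | f d. homogeneous d f}) Y))"
      unfolding zariski_def[symmetric] by (auto simp: openin_subtopology)
  next
    have "\<Union> {- zero_locus f | (f :: ('k, 'm) mpol) d. homogeneous d f} = UNIV"
      using topspace_zariski[where 'a = 'k and 'b = 'm]
      unfolding zariski_def topology_generated_by_topspace .
    then show "\<phi> ` topspace (subtopology (topology_generated_by
          {- zero_locus f | f d. homogeneous d f}) Y)
        \<subseteq> \<Union> {- zero_locus f | f d. homogeneous d f}"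
      by simp
  qed
  then have cont: "continuous_map (subtopology zariski Y) (subtopology zariski Z) \<phi>"
    using into by (auto simp: continuous_map_in_subtopology)
  moreover have "regular_on {p \<in> Y. \<phi> p \<in> V} (f \<circ> \<phi>)"
    if V: "openin (subtopology zariski Z) V" and f: "regular_on V f" for V f
    unfolding regular_on_def
  proof
    fix p assume p: "p \<in> {p \<in> Y. \<phi> p \<in> V}"
    then have "\<phi> p \<in> V" by simp
    from regular_onE[OF f this] obtain W d g h
      where W: "openin (subtopology zariski V) W" "\<phi> p \<in> W"
      and gh: "homogeneous d g" "homogeneous d h"
      and eq: "\<forall>q\<in>W. \<forall>v\<in>hom_coords q.
        mpol_eval h v \<noteq> 0 \<and> f q = mpol_eval g v / mpol_eval h v"
      by blast
    obtain g' h' where gh': "homogeneous (d * N) g'" "homogeneous (d * N) h'"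
      "\<And>v. mpol_eval g' v = mpol_eval g (G v)" "\<And>v. mpol_eval h' v = mpol_eval h (G v)"
      using comp gh by metis
    have "V \<subseteq> Z" using openin_subset[OF V] by simp
    have "openin (subtopology zariski Z) W"
      using W(1) V by (metis openin_trans_full subtopology_subtopology inf.absorb2 \<open>V \<subseteq> Z\<close>)
    then have "openin (subtopology zariski Y) {q \<in> Y. \<phi> q \<in> W}"
      using openin_continuous_map_preimage[OF cont] by fastforce
    moreover have "W \<subseteq> V" using openin_subset[OF W(1)] by simp
    ultimately have W': "openin (subtopology zariski {p \<in> Y. \<phi> p \<in> V}) {q \<in> Y. \<phi> q \<in> W}"
      unfolding openin_subtopology by blast
    have "mpol_eval h' v \<noteq> 0 \<and> (f \<circ> \<phi>) q = mpol_eval g' v / mpol_eval h' v"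
      if "q \<in> {q \<in> Y. \<phi> q \<in> W}" "v \<in> hom_coords q" for q v
    proof -
      from that have "v \<noteq> 0" "abs_proj v = q" by (auto simp: hom_coords_def)
      with that maps[of v] have "G v \<in> hom_coords (\<phi> q)" by (auto simp: hom_coords_def)
      then have "mpol_eval h (G v) \<noteq> 0 \<and> f (\<phi> q) = mpol_eval g (G v) / mpol_eval h (G v)"
        using eq that by blast
      then show ?thesis by (simp add: gh'(3,4))
    qed
    with W' p W(2) gh'(1,2) show "\<exists>W d g h. openin (subtopology zariski {p \<in> Y. \<phi> p \<in> V}) W \<and> p \<in> W \<and>
        homogeneous d g \<and> homogeneous d h \<and> (\<forall>q\<in>W. \<forall>v\<in>hom_coords q.
          mpol_eval h v \<noteq> 0 \<and> (f \<circ> \<phi>) q = mpol_eval g v / mpol_eval h v)"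
      by (intro exI[of _ "{q \<in> Y. \<phi> q \<in> W}"] exI[of _ "d * N"] exI[of _ g'] exI[of _ h']) auto
  qed
  ultimately show ?thesis unfolding morphism_on_def by blast
qed

text \<open>
  The pullback of a ratio of two linear forms is a quotient \<open>a / b\<close> of forms near the point, and
  clearing denominators gives a polynomial identity in the parameter of the curve.
\<close>

lemma morphism_on_curve_limit:
  fixes c g :: "'k::alg_closed_field \<Rightarrow> 'k ^ 'n::finite"
  assumes \<psi>: "morphism_on UNIV UNIV \<psi>"
    and c: "polynomial_curve c" "c 0 \<noteq> 0" and g: "polynomial_curve g" "g 0 \<noteq> 0"
    and S: "finite S" "\<And>t. t \<notin> S \<Longrightarrow> \<psi> (abs_proj (c t)) = abs_proj (g t)"
  shows "\<psi> (abs_proj (c 0)) = abs_proj (g 0)"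
proof (rule ccontr)
  assume neq: "\<psi> (abs_proj (c 0)) \<noteq> abs_proj (g 0)"
  obtain a where a: "a \<noteq> 0" "\<psi> (abs_proj (c 0)) = abs_proj a" by (rule proj_exhaust)
  obtain j where j: "g 0 $ j \<noteq> 0" using g(2) by (auto simp: vec_eq_iff)
  \<comment> \<open>Two different projective points have a non-zero two-by-two minor, and one column
    may be chosen as \<open>j\<close> because \<open>g 0 $ j\<close> is not 0.\<close>
  have "\<exists>i. a $ i * g 0 $ j \<noteq> a $ j * g 0 $ i"
  proof (rule ccontr)
    assume "\<not> ?thesis"
    then have *: "a = (a $ j / g 0 $ j) *s g 0"
      using j by (auto simp: vec_eq_iff field_simps)
    then have "a $ j / g 0 $ j \<noteq> 0" using a(1) by (metis vector_smult_lzero)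
    then show False using * neq a(2) abs_proj_scale[OF g(2)] by metis
  qed
  then obtain i where i: "a $ i * g 0 $ j \<noteq> a $ j * g 0 $ i" by blast
  \<comment> \<open>The hyperplane \<open>l = 0\<close> contains \<open>g 0\<close> but not
    \<open>a\<close>, so \<open>V\<close> below is a neighbourhood of the supposed image that avoids
    the class of \<open>g 0\<close>.\<close>
  define l where "l v = g 0 $ j * v $ i - g 0 $ i * v $ j" for v :: "'k ^ 'n"
  have l: "form 1 l"
    unfolding l_def by (intro form_diff form_scale form_coord)
  have la: "l a \<noteq> 0" using i by (simp add: l_def mult_ac)
  have l0: "l (g 0) = 0" by (simp add: l_def)
  obtain V where V: "openin zariski V" "\<And>v. v \<noteq> 0 \<Longrightarrow> abs_proj v \<in> V \<longleftrightarrow> l v \<noteq> 0"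
    using openin_zariski_nonzero[OF l] by blast
  \<comment> \<open>The quotient of the \<open>j\<close>-th coordinate by \<open>l\<close> is
    independent of the representative and has a pole at \<open>g 0\<close>.\<close>
  define f where "f p = (let v = (SOME v. v \<in> hom_coords p) in v $ j / l v)" for p
  have f: "f (abs_proj v) = v $ j / l v" if v: "v \<noteq> 0" for v
  proof -
    have "v \<in> hom_coords (abs_proj v)" using that by (simp add: hom_coords_def)
    then have "(SOME w. w \<in> hom_coords (abs_proj v)) \<in> hom_coords (abs_proj v)" by (rule someI)
    then obtain d where "d \<noteq> 0" "(SOME w. w \<in> hom_coords (abs_proj v)) = d *s v"
      using mem_hom_coords_abs_proj[OF v] by blast
    then show ?thesis using form_homogeneous[OF l, of d v] by (simp add: f_def)
  qed
  have "regular_on V f"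
    unfolding regular_on_def
  proof
    fix p assume "p \<in> V"
    obtain A B :: "('k, 'n) mpol" where AB: "homogeneous 1 A" "\<And>v. mpol_eval A v = v $ j"
      "homogeneous 1 B" "\<And>v. mpol_eval B v = l v"
      using l form_coord[of j] unfolding form_iff_mpol_eval by metis
    have "\<forall>q\<in>V. \<forall>v\<in>hom_coords q. mpol_eval B v \<noteq> 0 \<and> f q = mpol_eval A v / mpol_eval B v"
      using f V(2) by (auto simp: hom_coords_def AB(2,4))
    then show "\<exists>W d g h. openin (subtopology zariski V) W \<and> p \<in> W \<and> homogeneous d g \<and>
        homogeneous d h \<and> (\<forall>q\<in>W. \<forall>v\<in>hom_coords q.
          mpol_eval h v \<noteq> 0 \<and> f q = mpol_eval g v / mpol_eval h v)"
      using \<open>p \<in> V\<close> AB(1,3) V(1)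
      by (intro exI[of _ V] exI[of _ 1] exI[of _ A] exI[of _ B])
        (auto simp: openin_subtopology)
  qed
  then have reg: "regular_on {p. \<psi> p \<in> V} (f \<circ> \<psi>)"
    using \<psi> V(1) unfolding morphism_on_def by (auto simp: subtopology_UNIV)
  have "continuous_map zariski zariski \<psi>"
    using \<psi> unfolding morphism_on_def by (simp add: subtopology_UNIV)
  then have V': "openin zariski {p. \<psi> p \<in> V}"
    using openin_continuous_map_preimage[of zariski zariski \<psi> V] V(1) by simp
  have "\<psi> (abs_proj (c 0)) \<in> V" using V(2) a la by simp
  then obtain W d A B where W: "openin (subtopology zariski {p. \<psi> p \<in> V}) W" "abs_proj (c 0) \<in> W"
    and AB: "homogeneous d A" "homogeneous d B"
    and eq: "\<forall>q\<in>W. \<forall>v\<in>hom_coords q.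
      mpol_eval B v \<noteq> 0 \<and> f (\<psi> q) = mpol_eval A v / mpol_eval B v"
    using regular_onE[OF reg, of "abs_proj (c 0)"] unfolding comp_def mem_Collect_eq by blast
  have "openin zariski W" using W(1) V' by (metis openin_trans_full)
  have "W \<subseteq> {p. \<psi> p \<in> V}" using openin_subset[OF W(1)] by simp
  obtain p1 p2 p3 p4 where p: "\<And>t. mpol_eval A (c t) = poly p1 t" "\<And>t. mpol_eval B (c t) = poly p2 t"
    "\<And>t. g t $ j = poly p3 t" "\<And>t. l (g t) = poly p4 t"
    using form_on_polynomial_curve[OF form_mpol_eval[OF AB(1)] c(1)]
      form_on_polynomial_curve[OF form_mpol_eval[OF AB(2)] c(1)]
      form_on_polynomial_curve[OF form_coord g(1)] form_on_polynomial_curve[OF l g(1)] by metis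
  have "p1 * p4 = p2 * p3"
  proof (rule poly_eq_if_cofinite_eq)
    have "finite {t. g t $ j = 0}"
      using form_finite_zeros_on_curve[OF form_coord g(1) j] .
    then show "finite (S \<union> {t. c t = 0 \<or> abs_proj (c t) \<notin> W} \<union> {t. g t $ j = 0})"
      using S(1) finite_curve_outside_open[OF \<open>openin zariski W\<close> c W(2)] by simp
    fix t assume "t \<notin> S \<union> {t. c t = 0 \<or> abs_proj (c t) \<notin> W} \<union> {t. g t $ j = 0}"
    then have t: "t \<notin> S" "c t \<noteq> 0" "abs_proj (c t) \<in> W" "g t \<noteq> 0" by auto
    have "abs_proj (g t) \<in> V" using S(2) t \<open>W \<subseteq> _\<close> by auto
    then have "l (g t) \<noteq> 0" using V(2) t by simp
    moreover have "mpol_eval B (c t) \<noteq> 0" "f (\<psi> (abs_proj (c t))) = mpol_eval A (c t) / mpol_eval B (c t)"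
      using eq t by (auto simp: hom_coords_def)
    ultimately show "poly (p1 * p4) t = poly (p2 * p3) t"
      using f t S(2) by (simp add: field_simps flip: p)
  qed
  \<comment> \<open>At parameter 0 the left side vanishes with \<open>l (g 0)\<close>, while both
    factors on the right are non-zero.\<close>
  then have "mpol_eval A (c 0) * l (g 0) = mpol_eval B (c 0) * g 0 $ j"
    by (simp add: p flip: poly_mult)
  moreover have "mpol_eval B (c 0) \<noteq> 0"
    using eq W(2) c(2) by (simp add: hom_coords_def)
  ultimately show False using l0 j by simp
qed

lemma Aut_inj:
  assumes "\<psi> \<in> Aut UNIV" and "\<psi> p = \<psi> q"
  shows "p = q"
proof -
  obtain \<eta> where "\<And>p. \<eta> (\<psi> p) = p" using assms(1) unfolding Aut_def by blast
  then show ?thesis using assms(2) by metis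
qed

text \<open>After clearing denominators both maps are given by forms. Preservation of
  \<open>F\<close> keeps the images off the hypersurface and away from the vector 0.\<close>

lemma localized_automorphism:
  fixes F :: "('k::field, 'n::finite) mpol"
  assumes F: "homogeneous 3 F"
    and \<theta>: "\<And>i. localized_form (mpol_eval F) 1 (\<lambda>q. \<theta> q $ i)"
    and \<theta>': "\<And>i. localized_form (mpol_eval F) 1 (\<lambda>q. \<theta>' q $ i)"
    and F\<theta>: "\<And>q. mpol_eval F q \<noteq> 0 \<Longrightarrow> mpol_eval F (\<theta> q) = mpol_eval F q"
    and F\<theta>': "\<And>q. mpol_eval F q \<noteq> 0 \<Longrightarrow> mpol_eval F (\<theta>' q) = mpol_eval F q"
    and inv: "\<And>q. mpol_eval F q \<noteq> 0 \<Longrightarrow> \<theta>' (\<theta> q) = q"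
    and inv': "\<And>q. mpol_eval F q \<noteq> 0 \<Longrightarrow> \<theta> (\<theta>' q) = q"
  shows "\<exists>\<phi>\<in>Aut (UNIV - zero_locus F).
    \<forall>q. mpol_eval F q \<noteq> 0 \<longrightarrow> \<phi> (abs_proj q) = abs_proj (\<theta> q)"
proof -
  let ?Y = "UNIV - zero_locus F"
  have F0: "mpol_eval F 0 = 0" by (rule form_eq_0_at_0[OF form_mpol_eval[OF F]]) simp
  have Y: "abs_proj q \<in> ?Y \<longleftrightarrow> mpol_eval F q \<noteq> 0" if "q \<noteq> 0" for q
    using mem_zero_locus_abs_proj[OF F that] by simp
  have *: "\<exists>\<phi>. morphism_on ?Y ?Y \<phi> \<and>
      (\<forall>q. mpol_eval F q \<noteq> 0 \<longrightarrow> \<phi> (abs_proj q) = abs_proj (\<theta> q))"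
    if loc: "\<And>i. localized_form (mpol_eval F) 1 (\<lambda>q. \<theta> q $ i)"
      and F\<theta>: "\<And>q. mpol_eval F q \<noteq> 0 \<Longrightarrow> mpol_eval F (\<theta> q) = mpol_eval F q" for \<theta>
  proof -
    obtain n G where G: "\<And>i. form (1 + 3 * n) (\<lambda>q. G q $ i)"
      "\<And>q. mpol_eval F q \<noteq> 0 \<Longrightarrow> G q = mpol_eval F q ^ n *s \<theta> q"
      using localized_vector[OF loc] by blast
    \<comment> \<open>The choice of representative is harmless because \<open>G\<close> is
      homogeneous.\<close>
    define \<phi> where "\<phi> p = abs_proj (G (SOME v. v \<in> hom_coords p))" for p
    have nz: "q \<noteq> 0" "\<theta> q \<noteq> 0" "G q \<noteq> 0" "abs_proj (G q) = abs_proj (\<theta> q)"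
      if "mpol_eval F q \<noteq> 0" for q
    proof -
      show "q \<noteq> 0" using that F0 by metis
      show "\<theta> q \<noteq> 0" using that F0 F\<theta> by metis
      then show "G q \<noteq> 0" using G(2) that by (auto simp: vec_eq_iff)
      show "abs_proj (G q) = abs_proj (\<theta> q)"
        using G(2) that \<open>\<theta> q \<noteq> 0\<close> abs_proj_scale[of "\<theta> q" "mpol_eval F q ^ n"] by simp
    qed
    have \<phi>: "\<phi> (abs_proj q) = abs_proj (G q)" if q: "mpol_eval F q \<noteq> 0" for q
    proof -
      have "q \<in> hom_coords (abs_proj q)" using nz(1)[OF that] by (simp add: hom_coords_def)
      then have "(SOME w. w \<in> hom_coords (abs_proj q)) \<in> hom_coords (abs_proj q)" by (rule someI)
      then obtain d where d: "d \<noteq> 0" "(SOME w. w \<in> hom_coords (abs_proj q)) = d *s q"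
        using mem_hom_coords_abs_proj[OF nz(1)[OF q]] by blast
      have "G (d *s q) = d ^ (1 + 3 * n) *s G q"
        using form_homogeneous[OF G(1)] by (auto simp: vec_eq_iff)
      then show ?thesis using d abs_proj_scale[OF nz(3)[OF that]] by (simp add: \<phi>_def)
    qed
    have "morphism_on ?Y ?Y \<phi>"
    proof (rule morphism_onI_forms[OF G(1)])
      fix v assume "v \<noteq> 0" "abs_proj v \<in> ?Y"
      then have v: "mpol_eval F v \<noteq> 0" using Y by blast
      then have "abs_proj (\<theta> v) \<in> ?Y" using Y[OF nz(2)[OF v]] F\<theta> by simp
      then show "G v \<noteq> 0 \<and> \<phi> (abs_proj v) = abs_proj (G v) \<and> abs_proj (G v) \<in> ?Y"
        using nz[OF v] \<phi>[OF v] by simp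
    qed
    then show ?thesis using \<phi> nz(4) by auto
  qed
  obtain \<phi> where \<phi>: "morphism_on ?Y ?Y \<phi>" "\<And>q. mpol_eval F q \<noteq> 0 \<Longrightarrow> \<phi> (abs_proj q) = abs_proj (\<theta> q)"
    using *[OF \<theta> F\<theta>] by blast
  obtain \<psi> where \<psi>: "morphism_on ?Y ?Y \<psi>" "\<And>q. mpol_eval F q \<noteq> 0 \<Longrightarrow> \<psi> (abs_proj q) = abs_proj (\<theta>' q)"
    using *[OF \<theta>' F\<theta>'] by blast
  have "\<psi> (\<phi> p) = p \<and> \<phi> (\<psi> p) = p" if "p \<in> ?Y" for p
  proof -
    obtain q where q: "q \<noteq> 0" "p = abs_proj q" by (rule proj_exhaust)
    then have "mpol_eval F q \<noteq> 0" using Y that by blast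
    then show ?thesis using q \<phi>(2) \<psi>(2) F\<theta> F\<theta>' inv inv' by simp
  qed
  then have "\<phi> \<in> Aut ?Y" unfolding Aut_def using \<phi>(1) \<psi>(1) by blast
  then show ?thesis using \<phi>(2) by blast
qed

section \<open>Non-extendable automorphisms\<close>

lemma polynomial_curve_form:
  assumes "\<And>i. form N (\<lambda>v. G v $ i)" and "polynomial_curve c"
  shows "polynomial_curve (\<lambda>t. G (c t))"
  using form_on_polynomial_curve[OF assms(1) assms(2)] by (simp add: polynomial_curve_def)

text \<open>Clears the pole of \<open>p (l / t)\<close> at \<open>t = 0\<close>. As \<open>d\<close>
  may exceed the degree, all coordinates of a curve can be reversed with one
  \<open>d\<close>.\<close>

lemma polynomial_reversal:
  fixes p :: "'k::field poly"
  assumes "degree p \<le> d"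
  shows "\<exists>r. poly r 0 = l ^ d * coeff p d \<and> (\<forall>t. t \<noteq> 0 \<longrightarrow> poly r t = t ^ d * poly p (l / t))"
proof -
  define r where "r = (\<Sum>k\<le>d. monom (coeff p k * l ^ k) (d - k))"
  have p: "poly p x = (\<Sum>k\<le>d. coeff p k * x ^ k)" for x
    unfolding poly_altdef using assms by (intro sum.mono_neutral_left) (auto simp: coeff_eq_0)
  have "poly r 0 = (\<Sum>k\<le>d. if k = d then coeff p k * l ^ k else 0)"
    unfolding r_def poly_sum poly_monom by (intro sum.cong) (auto simp: power_0_left)
  then have "poly r 0 = l ^ d * coeff p d" by simp
  moreover have "poly r t = t ^ d * poly p (l / t)" if "t \<noteq> 0" for t
    unfolding r_def poly_sum poly_monom p sum_distrib_left
    using that by (intro sum.cong) (auto simp: power_diff power_divide)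
  ultimately show ?thesis by blast
qed

lemma coeff_pcompose_translate:
  fixes p :: "'k::field poly"
  assumes "degree p \<le> d"
  shows "coeff (pcompose p [:x, 1:]) d = coeff p d"
proof (cases "degree p = d")
  case True
  then show ?thesis using lead_coeff_comp[of "[:x, 1:]" p] by (simp add: degree_pcompose)
next
  case False
  then show ?thesis using assms by (simp add: coeff_eq_0 degree_pcompose)
qed

text \<open>
  A polynomial curve has a limit point at infinity in projective space, the class of its leading
  coefficient vector \<open>a\<close>, and reparametrising it by a translation does not change that point.
\<close>

lemma polynomial_curve_at_infinity:
  fixes c :: "'k::alg_closed_field \<Rightarrow> 'k ^ 'n::finite"
  assumes "polynomial_curve c" and "c s0 \<noteq> 0"
  shows "\<exists>d a. a \<noteq> 0 \<and> (\<forall>l x e. \<exists>g. polynomial_curve g \<and> g 0 = l ^ d *s a \<and>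
    (\<forall>t. t \<noteq> 0 \<longrightarrow> g t = t ^ d *s (c (l / t + x) + t *s e)))"
proof -
  obtain p where p: "\<And>s i. c s $ i = poly (p i) s"
    using assms(1) unfolding polynomial_curve_def by metis
  define d where "d = Max (range (\<lambda>i. degree (p i)))"
  define a where "a = (\<chi> i. coeff (p i) d)"
  have deg: "degree (p i) \<le> d" for i unfolding d_def by (intro Max_ge) auto
  have "d \<in> range (\<lambda>i. degree (p i))" unfolding d_def by (intro Max_in) auto
  then obtain j where j: "degree (p j) = d" by blast
  \<comment> \<open>If \<open>d > 0\<close>, the coordinate \<open>j\<close> attains the degree
    \<open>d\<close>; a constant curve needs the assumption at \<open>s0\<close> instead.\<close>
  have "a \<noteq> 0"
  proof (cases "d = 0")
    case True
    obtain i where "poly (p i) s0 \<noteq> 0" using assms(2) p by (auto simp: vec_eq_iff)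
    moreover have "degree (p i) = 0" using deg[of i] True by simp
    ultimately have "coeff (p i) d \<noteq> 0" using True by (auto elim!: degree_eq_zeroE)
    then show ?thesis by (auto simp: a_def vec_eq_iff)
  next
    case False
    then have "coeff (p j) d \<noteq> 0" using j by (metis degree_0 leading_coeff_0_iff)
    then show ?thesis by (auto simp: a_def vec_eq_iff)
  qed
  moreover have "\<exists>g. polynomial_curve g \<and> g 0 = l ^ d *s a \<and>
    (\<forall>t. t \<noteq> 0 \<longrightarrow> g t = t ^ d *s (c (l / t + x) + t *s e))" for l x e
  proof -
    have "\<exists>r. poly r 0 = l ^ d * coeff (p i) d \<and>
        (\<forall>t. t \<noteq> 0 \<longrightarrow> poly r t = t ^ d * poly (p i) (l / t + x))" for i
      using polynomial_reversal[of "pcompose (p i) [:x, 1:]" d l] deg[of i]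
      by (simp add: coeff_pcompose_translate degree_pcompose poly_pcompose add.commute)
    then obtain r where r: "\<And>i. poly (r i) 0 = l ^ d * coeff (p i) d"
      "\<And>i t. t \<noteq> 0 \<Longrightarrow> poly (r i) t = t ^ d * poly (p i) (l / t + x)" by metis
    \<comment> \<open>The translation by \<open>t *s e\<close> contributes the monomial of degree
      \<open>d + 1\<close>, which vanishes at 0.\<close>
    define g where "g t = (\<chi> i. poly (r i + monom (e $ i) (Suc d)) t)" for t
    have "polynomial_curve g" by (auto simp: polynomial_curve_def g_def simp del: poly_add)
    moreover have "g 0 = l ^ d *s a" by (simp add: g_def a_def vec_eq_iff r(1) poly_monom)
    moreover have "g t = t ^ d *s (c (l / t + x) + t *s e)" if "t \<noteq> 0" for t
      using that by (simp add: g_def vec_eq_iff r(2) poly_monom p algebra_simps)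
    ultimately show ?thesis by blast
  qed
  ultimately show ?thesis by blast
qed

text \<open>Criterion for non-extendability: two lines in the direction \<open>r\<close> start at
  distinct points, while their images under \<theta> follow curves with the same point at parameter
  0. By \<open>morphism_on_curve_limit\<close> an extension would identify the two starting
  points.\<close>

lemma contracting_automorphism:
  fixes F :: "('k::alg_closed_field, 'n::finite) mpol"
  assumes F: "homogeneous 3 F"
    and \<theta>: "\<And>i. localized_form (mpol_eval F) 1 (\<lambda>q. \<theta> q $ i)"
    and \<theta>': "\<And>i. localized_form (mpol_eval F) 1 (\<lambda>q. \<theta>' q $ i)"
    and F\<theta>: "\<And>q. mpol_eval F q \<noteq> 0 \<Longrightarrow> mpol_eval F (\<theta> q) = mpol_eval F q"
    and F\<theta>': "\<And>q. mpol_eval F q \<noteq> 0 \<Longrightarrow> mpol_eval F (\<theta>' q) = mpol_eval F q"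
    and inv: "\<And>q. mpol_eval F q \<noteq> 0 \<Longrightarrow> \<theta>' (\<theta> q) = q"
    and inv': "\<And>q. mpol_eval F q \<noteq> 0 \<Longrightarrow> \<theta> (\<theta>' q) = q"
    and q: "q1 \<noteq> 0" "q2 \<noteq> 0" "abs_proj q1 \<noteq> abs_proj q2"
    and g: "polynomial_curve g1" "polynomial_curve g2" "g1 0 = g2 0" "g1 0 \<noteq> 0"
    and S: "finite S" "\<And>t. t \<notin> S \<Longrightarrow> mpol_eval F (q1 + t *s r) \<noteq> 0 \<and> mpol_eval F (q2 + t *s r) \<noteq> 0"
    and g1: "\<And>t. t \<notin> S \<Longrightarrow> \<exists>a. a \<noteq> 0 \<and> g1 t = a *s \<theta> (q1 + t *s r)"
    and g2: "\<And>t. t \<notin> S \<Longrightarrow> \<exists>a. a \<noteq> 0 \<and> g2 t = a *s \<theta> (q2 + t *s r)"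
  shows "\<exists>\<phi>\<in>Aut (UNIV - zero_locus F).
    \<not> (\<exists>\<psi>\<in>Aut UNIV. \<forall>p\<in>UNIV - zero_locus F. \<psi> p = \<phi> p)"
proof -
  obtain \<phi> where \<phi>: "\<phi> \<in> Aut (UNIV - zero_locus F)"
    "\<And>q. mpol_eval F q \<noteq> 0 \<Longrightarrow> \<phi> (abs_proj q) = abs_proj (\<theta> q)"
    using localized_automorphism[OF F \<theta> \<theta>' F\<theta> F\<theta>' inv inv'] by blast
  have "\<not> (\<forall>p\<in>UNIV - zero_locus F. \<psi> p = \<phi> p)" if \<psi>: "\<psi> \<in> Aut UNIV" for \<psi>
  proof
    assume ext: "\<forall>p\<in>UNIV - zero_locus F. \<psi> p = \<phi> p"
    have F0: "mpol_eval F 0 = 0" by (rule form_eq_0_at_0[OF form_mpol_eval[OF F]]) simp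
    have val: "\<psi> (abs_proj v) = abs_proj w"
      if "mpol_eval F v \<noteq> 0" "\<exists>a. a \<noteq> 0 \<and> w = a *s \<theta> v" for v w
    proof -
      have "v \<noteq> 0" "\<theta> v \<noteq> 0" using that(1) F0 F\<theta> by metis+
      then have "\<psi> (abs_proj v) = abs_proj (\<theta> v)"
        using ext \<phi>(2) that(1) mem_zero_locus_abs_proj[OF F] by simp
      then show ?thesis using that(2) abs_proj_scale[OF \<open>\<theta> v \<noteq> 0\<close>] by auto
    qed
    have mor: "morphism_on UNIV UNIV \<psi>" using \<psi> by (simp add: Aut_def)
    have "\<psi> (abs_proj q1) = abs_proj (g1 0)"
      using morphism_on_curve_limit[OF mor polynomial_curve_line[of q1 r] _ g(1,4) S(1)]
        val S(2) g1 q(1) by simp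
    moreover have "\<psi> (abs_proj q2) = abs_proj (g2 0)"
      using morphism_on_curve_limit[OF mor polynomial_curve_line[of q2 r] _ g(2) _ S(1)]
        val S(2) g2 q(2) g(3,4) by simp
    ultimately show False using Aut_inj[OF \<psi>] g(3) q(3) by metis
  qed
  then show ?thesis using \<phi>(1) by blast
qed

text \<open>The map multiplied by \<open>F\<close> extends to the hypersurface and sends its points
  with \<open>l\<close> non-zero to the vertex \<open>e\<close>. Hence \<open>q1\<close> and
  \<open>q1 + e\<close> are contracted together.\<close>

lemma cone_non_extendable_automorphism:
  fixes F :: "('k::alg_closed_field, 'n::finite) mpol"
  assumes F: "homogeneous 3 F" and r: "mpol_eval F r \<noteq> 0"
    and cone: "\<And>q t. mpol_eval F (q + t *s e) = mpol_eval F q"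
    and l: "form 1 l" "l e = 0" and q1: "mpol_eval F q1 = 0" "l q1 \<noteq> 0" and e: "e \<noteq> 0"
  shows "\<exists>\<phi>\<in>Aut (UNIV - zero_locus F).
    \<not> (\<exists>\<psi>\<in>Aut UNIV. \<forall>p\<in>UNIV - zero_locus F. \<psi> p = \<phi> p)"
proof -
  have Ff: "form 3 (mpol_eval F)" using F by (rule form_mpol_eval)
  have le: "l (q + t *s e) = l q" for q t by (simp add: linear_form_line[OF l(1)] l(2))
  \<comment> \<open>The exponent 4 makes the coefficient of \<open>e\<close> homogeneous of degree
    1. This coefficient is invariant under translation by \<open>e\<close>, so \<open>- c\<close>
    gives the inverse.\<close>
  define \<theta> where "\<theta> c q = q + (c * l q ^ 4 / mpol_eval F q) *s e" for c q
  have F\<theta>: "mpol_eval F (\<theta> c q) = mpol_eval F q" for c q by (simp add: \<theta>_def cone)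
  have l4: "form 4 (\<lambda>q. l q ^ 4)" using form_power[OF l(1), of 4] by simp
  have \<theta>: "localized_form (mpol_eval F) 1 (\<lambda>q. \<theta> c q $ i)" for c i
  proof -
    have "localized_form (mpol_eval F) 1 (\<lambda>q. q $ i + (c * e $ i) * l q ^ 4 / mpol_eval F q)"
      by (intro localized_form_add localized_form_divide localized_form_form Ff form_coord
          form_scale) (simp add: l4)
    then show ?thesis by (simp add: \<theta>_def mult_ac)
  qed
  have inv: "\<theta> (- c) (\<theta> c q) = q" for c q
    unfolding \<theta>_def cone le by (simp add: vec_eq_iff)
  have q10: "q1 \<noteq> 0" using q1(2) form_eq_0_at_0[OF l(1)] by auto
  have q2: "l (q1 + e) = l q1" "mpol_eval F (q1 + e) = 0"
    using le[of q1 1] cone[of q1 1] q1(1) by auto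
  then have q20: "q1 + e \<noteq> 0" using q1(2) form_eq_0_at_0[OF l(1)] by auto
  define G where "G q = mpol_eval F q *s q + l q ^ 4 *s e" for q
  have Gf: "form 4 (\<lambda>q. G q $ i)" for i
  proof -
    have "form 4 (\<lambda>q. mpol_eval F q * q $ i)"
      by (rule form_mult'[OF Ff form_coord]) simp
    then have "form 4 (\<lambda>q. mpol_eval F q * q $ i + e $ i * l q ^ 4)"
      by (intro form_add form_scale l4)
    then show ?thesis by (simp add: G_def mult.commute)
  qed
  have G\<theta>: "\<exists>a. a \<noteq> 0 \<and> G q = a *s \<theta> 1 q" if "mpol_eval F q \<noteq> 0" for q
    using that by (intro exI[of _ "mpol_eval F q"]) (auto simp: G_def \<theta>_def vec_eq_iff algebra_simps)
  show ?thesis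
  proof (rule contracting_automorphism[where \<theta> = "\<theta> 1" and \<theta>' = "\<theta> (- 1)" and ?q1.0 = q1
        and ?q2.0 = "q1 + e" and r = "r - q1"
        and ?g1.0 = "\<lambda>t. G (q1 + t *s (r - q1))" and ?g2.0 = "\<lambda>t. G (q1 + e + t *s (r - q1))"
        and S = "{t. mpol_eval F (q1 + t *s (r - q1)) = 0}"])
    show "abs_proj q1 \<noteq> abs_proj (q1 + e)"
    proof
      assume "abs_proj q1 = abs_proj (q1 + e)"
      then obtain c where c: "q1 + e = c *s q1" using abs_proj_eq_iff[OF q10 q20] by blast
      then have "l q1 = c * l q1" using form_homogeneous[OF l(1), of c q1] q2(1) by simp
      then show False using c q1(2) e by simp
    qed
    have *: "mpol_eval F (q1 + e + t *s (r - q1)) = mpol_eval F (q1 + t *s (r - q1))" for t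
      using cone[of "q1 + t *s (r - q1)" 1] by (simp add: algebra_simps)
    show "finite {t. mpol_eval F (q1 + t *s (r - q1)) = 0}"
      by (rule form_finite_zeros_on_curve[OF Ff polynomial_curve_line, of _ 1]) (simp add: r)
    show "mpol_eval F (q1 + t *s (r - q1)) \<noteq> 0 \<and> mpol_eval F (q1 + e + t *s (r - q1)) \<noteq> 0"
      "\<exists>a. a \<noteq> 0 \<and> G (q1 + t *s (r - q1)) = a *s \<theta> 1 (q1 + t *s (r - q1))"
      "\<exists>a. a \<noteq> 0 \<and> G (q1 + e + t *s (r - q1)) = a *s \<theta> 1 (q1 + e + t *s (r - q1))"
      if "t \<notin> {t. mpol_eval F (q1 + t *s (r - q1)) = 0}" for t
      using that * G\<theta> by auto
    show "G (q1 + 0 *s (r - q1)) = G (q1 + e + 0 *s (r - q1))" "G (q1 + 0 *s (r - q1)) \<noteq> 0"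
      using q2 q1 e by (auto simp: G_def)
    show "polynomial_curve (\<lambda>t. G (q1 + t *s (r - q1)))"
      "polynomial_curve (\<lambda>t. G (q1 + e + t *s (r - q1)))"
      by (rule polynomial_curve_form[OF Gf polynomial_curve_line])+
  qed (use F \<theta> F\<theta> inv[of 1] inv[of "- 1"] q10 q20 in auto)
qed

text \<open>
  With \<open>\<rho> s q = q + s D s q\<close> a unipotent one-parameter group, \<open>\<theta> \<sigma>\<close> lifts the transformation \<open>\<rho> (Q q \<sigma>)\<close>
  by a translation along \<open>e\<close> chosen to preserve \<open>F\<close>, and \<open>\<sigma> = l / F\<close> makes it homogeneous.
\<close>

lemma unipotent_non_extendable_automorphism:
  fixes F :: "('k::alg_closed_field, 'n::finite) mpol"
  assumes F: "homogeneous 3 F" and Q: "form 2 Q"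
    and FQ: "\<And>q t. mpol_eval F (q + t *s e) = mpol_eval F q + t * Q q"
    and l: "form 1 l" "l e = 0"
    and ne: "l a \<noteq> 0" "Q b \<noteq> 0"
    and D: "\<And>i. parametric_form 1 (\<lambda>s q. D s q $ i)"
    and \<rho>_def: "\<rho> = (\<lambda>s q. q + s *s D s q)"
    and Q\<rho>: "\<And>s q. Q (\<rho> s q) = Q q" and l\<rho>: "\<And>s q. l (\<rho> s q) = l q"
    and \<rho>\<rho>: "\<And>s t q. \<rho> s (\<rho> t q) = \<rho> (s + t) q"
    and \<rho>e: "\<And>s t q. \<rho> s (q + t *s e) = \<rho> s q + t *s e"
    and \<rho>1: "\<And>q t. l q \<noteq> 0 \<Longrightarrow> \<rho> 1 q \<noteq> q + t *s e"
  shows "\<exists>\<phi>\<in>Aut (UNIV - zero_locus F).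
    \<not> (\<exists>\<psi>\<in>Aut UNIV. \<forall>p\<in>UNIV - zero_locus F. \<psi> p = \<phi> p)"
proof -
  let ?F = "mpol_eval F"
  have Ff: "form 3 ?F" using F by (rule form_mpol_eval)
  have Qe: "Q (q + t *s e) = Q q" for q t by (rule line_coefficient_invariant[OF FQ])
  have le: "l (q + t *s e) = l q" for q t by (simp add: linear_form_line[OF l(1)] l(2))
  have \<rho>f: "parametric_form 1 (\<lambda>s q. \<rho> s q $ i)" for i
  proof -
    have "parametric_form 1 (\<lambda>s q. q $ i + s * D s q $ i)"
      by (intro parametric_form.add parametric_form.form form_coord
          parametric_form_mult'[OF parametric_form.param D]) simp
    then show ?thesis by (simp add: \<rho>_def)
  qed
  obtain E where E: "parametric_form 3 E" "\<And>s q. ?F (\<rho> s q) = ?F q + s * E s q"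
    using parametric_form_difference_quotient[OF Ff \<rho>f D] \<rho>_def by blast
  \<comment> \<open>In \<open>F (\<rho> s q) - F q\<close> the terms linear in \<open>t\<close>
    cancel because \<open>Q\<close> is preserved. Dividing by \<open>s\<close> needs
    \<open>s\<close> non-zero; the value at 0 follows by polynomial identity.\<close>
  have Ee: "E s (q + t *s e) = E s q" for s t q
  proof -
    obtain p p' where p: "\<And>s. E s (q + t *s e) = poly p s" "\<And>s. E s q = poly p' s"
      using parametric_form_poly[OF E(1)] by metis
    have "p = p'"
    proof (rule poly_eq_if_cofinite_eq[of "{0}"])
      fix s :: 'k assume "s \<notin> {0}"
      moreover have "s * E s (q + t *s e) = s * E s q"
        using E(2)[of s "q + t *s e"] E(2)[of s q] by (auto simp: \<rho>e FQ Q\<rho>)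
      ultimately show "poly p s = poly p' s" by (simp flip: p)
    qed simp
    then show ?thesis by (simp add: p)
  qed
  have \<rho>0: "\<rho> 0 q = q" for q by (simp add: \<rho>_def)
  \<comment> \<open>For \<open>s = Q q * \<sigma>\<close> the quotient of
    \<open>F (\<rho> s q) - F q = s * E s q\<close> by \<open>Q q\<close> is
    \<open>\<sigma> * E s q\<close>, so no denominator \<open>Q\<close> remains.\<close>
  define \<theta> where "\<theta> \<sigma> q = \<rho> (Q q * \<sigma>) q + (- (\<sigma> * E (Q q * \<sigma>) q)) *s e" for \<sigma> q
  have F\<theta>: "?F (\<theta> \<sigma> q) = ?F q" for \<sigma> q
    by (simp only: \<theta>_def FQ E(2) Q\<rho>) simp
  have Q\<theta>: "Q (\<theta> \<sigma> q) = Q q" and l\<theta>: "l (\<theta> \<sigma> q) = l q" for \<sigma> q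
    by (simp_all only: \<theta>_def Qe Q\<rho> le l\<rho>)
  have inv: "\<theta> (- \<sigma>) (\<theta> \<sigma> q) = q" for \<sigma> q
  proof -
    define s where "s = Q q * \<sigma>"
    define q' where "q' = \<theta> \<sigma> q"
    have q': "q' = \<rho> s q + (- (\<sigma> * E s q)) *s e" by (simp only: q'_def \<theta>_def s_def)
    then have \<rho>q': "\<rho> (- s) q' = q + (- (\<sigma> * E s q)) *s e" by (simp only: \<rho>e \<rho>\<rho>) (simp add: \<rho>0)
    \<comment> \<open>Both sides appear in the value of \<open>F\<close> at
      \<open>\<rho> (- s) q'\<close>, from which \<open>s\<close> is cancelled; for
      \<open>s = 0\<close> the invariance of \<open>E\<close> under translation by \<open>e\<close>
      is enough.\<close>
    have "\<sigma> * E (- s) q' = \<sigma> * E s q"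
    proof (cases "s = 0")
      case True
      then show ?thesis unfolding q' Ee by (simp add: \<rho>0)
    next
      case False
      have "?F (\<rho> (- s) q') = ?F q + (- s) * E (- s) q'"
        unfolding E(2) by (simp add: q'_def F\<theta>)
      moreover have "?F (\<rho> (- s) q') = ?F q + (- s) * E s q"
        unfolding \<rho>q' FQ by (simp add: s_def)
      ultimately have "s * E (- s) q' = s * E s q" by auto
      then show ?thesis using False by simp
    qed
    moreover have "Q q' = Q q" by (simp only: q'_def Q\<theta>)
    then have "\<theta> (- \<sigma>) q' = \<rho> (- s) q' + (\<sigma> * E (- s) q') *s e"
      by (simp add: \<theta>_def[of "- \<sigma>" q'] s_def)
    ultimately show ?thesis using \<rho>q' by (simp add: q'_def vec_eq_iff)
  qed
  \<comment> \<open>Here \<sigma> has degree -2, so \<open>Q q * \<sigma>\<close> has degree 0. As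
    \<open>\<theta> \<sigma>\<close> preserves \<open>l\<close> and \<open>F\<close>, changing the
    sign of \<open>c\<close> gives the inverse.\<close>
  define \<Theta> where "\<Theta> c q = \<theta> (c * l q / ?F q) q" for c q
  have \<Theta>: "localized_form ?F 1 (\<lambda>q. \<Theta> c q $ i)" for c i
  proof -
    have u: "localized_form ?F 0 (\<lambda>q. c * (Q q * l q) / ?F q)"
      by (intro localized_form_divide localized_form_form Ff form_scale form_mult'[OF Q l(1)]) simp
    have "localized_form ?F (1 + 3) (\<lambda>q. (- c * e $ i) * l q * E (c * (Q q * l q) / ?F q) q)"
      by (rule localized_form_mult[OF localized_form_form[OF Ff form_scale[OF l(1)]]
            localized_form_parametric[OF E(1) Ff u]])
    then have "localized_form ?F 1 (\<lambda>q. \<rho> (c * (Q q * l q) / ?F q) q $ i +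
        (- c * e $ i) * l q * E (c * (Q q * l q) / ?F q) q / ?F q)"
      by (intro localized_form_add localized_form_divide localized_form_parametric[OF \<rho>f Ff u])
    then show ?thesis by (simp add: \<Theta>_def \<theta>_def mult_ac)
  qed
  have F\<Theta>: "?F (\<Theta> c q) = ?F q" for c q by (simp add: \<Theta>_def F\<theta>)
  have inv\<Theta>: "\<Theta> (- c) (\<Theta> c q) = q" for c q
    using inv[of "c * l q / ?F q" q] by (simp add: \<Theta>_def F\<theta> l\<theta>)

  obtain q0 where q0: "l q0 \<noteq> 0" "Q q0 \<noteq> 0" using forms_common_nonzero[OF l(1) Q ne] by blast
  \<comment> \<open>Along \<open>e\<close> the value of \<open>F\<close> changes with constant slope
    \<open>Q q0\<close>, so this translate lies on the hypersurface.\<close>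
  define q1 where "q1 = q0 + (- (?F q0 / Q q0)) *s e"
  have q1: "?F q1 = 0" "Q q1 \<noteq> 0" "l q1 \<noteq> 0"
    using q0 by (simp_all only: q1_def FQ Qe le) auto
  \<comment> \<open>The orbit of \<open>q1\<close> projected along \<open>e\<close> to the
    hypersurface.\<close>
  define c where "c s = \<rho> s q1 + (- (?F (\<rho> s q1) / Q q1)) *s e" for s
  have c0: "c 0 = q1" by (simp add: c_def \<rho>0 q1(1))
  have Fc: "?F (c s) = 0" and Qc: "Q (c s) = Q q1" and lc: "l (c s) = l q1" for s
    using q1(2) by (simp_all only: c_def FQ Qe le Q\<rho> l\<rho>) auto
  \<comment> \<open>Applying \<open>\<rho> s\<close> and projecting again shifts the parameter of
    the curve by \<open>s\<close>.\<close>
  have cs: "\<rho> s (c x) + (- (?F (\<rho> s (c x)) / Q q1)) *s e = c (s + x)" for s x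
  proof -
    define y where "y = - (?F (\<rho> x q1) / Q q1)"
    have "\<rho> s (c x) = \<rho> (s + x) q1 + y *s e" by (simp only: c_def y_def \<rho>e \<rho>\<rho>)
    moreover have "?F (\<rho> s (c x)) = ?F (\<rho> (s + x) q1) + y * Q q1"
      using calculation by (simp only: FQ Q\<rho>)
    ultimately show ?thesis using q1(2) by (simp add: c_def vec_eq_iff field_simps)
  qed
  \<comment> \<open>On this line \<open>F\<close> has the value \<open>t * Q q1\<close>, so the
    group parameter becomes \<open>l q1 / t\<close>, with a pole at \<open>t = 0\<close>: the image
    runs along the curve \<open>c\<close> to infinity.\<close>
  have \<Theta>c: "\<Theta> 1 (c x + t *s e) = c (l q1 / t + x) + t *s e" if "t \<noteq> 0" for x t
  proof -
    define s where "s = l q1 / t"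
    have F: "?F (c x + t *s e) = t * Q q1" by (simp only: FQ Fc Qc) simp
    have \<sigma>: "1 * l (c x + t *s e) / ?F (c x + t *s e) = s / Q q1"
      unfolding F by (simp add: le lc s_def)
    have "s * E s (c x + t *s e) = ?F (\<rho> s (c x))"
      unfolding Ee using E(2)[of s "c x"] Fc by simp
    then have "\<Theta> 1 (c x + t *s e) = \<rho> s (c x) + t *s e - (?F (\<rho> s (c x)) / Q q1) *s e"
      unfolding \<Theta>_def \<theta>_def \<sigma> using q1(2) by (simp add: Qe Qc \<rho>e field_simps)
    also have "\<dots> = c (s + x) + t *s e" unfolding cs[symmetric] by (simp add: vec_eq_iff)
    finally show ?thesis by (simp add: s_def)
  qed
  have c_poly: "polynomial_curve c"
    unfolding polynomial_curve_def
  proof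
    fix i
    have "parametric_form 3 (\<lambda>s q. ?F (\<rho> s q))"
      using parametric_form_difference_quotient[OF Ff \<rho>f D] \<rho>_def by blast
    from parametric_form_poly[OF this, of q1] obtain p where "\<And>s. ?F (\<rho> s q1) = poly p s"
      by blast
    moreover from parametric_form_poly[OF \<rho>f[of i], of q1] obtain p'
      where "\<And>s. \<rho> s q1 $ i = poly p' s" by blast
    ultimately show "\<exists>p. \<forall>s. c s $ i = poly p s"
      by (intro exI[of _ "p' + smult (- (e $ i / Q q1)) p"]) (simp add: c_def)
  qed
  have l0: "l 0 = 0" by (rule form_eq_0_at_0[OF l(1)]) simp
  have c_nz: "c x \<noteq> 0" for x using lc[of x] q1(3) l0 by auto
  obtain d a where a: "a \<noteq> 0"
    and lim: "\<And>l x e. \<exists>g. polynomial_curve g \<and> g 0 = l ^ d *s a \<and>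
      (\<forall>t. t \<noteq> 0 \<longrightarrow> g t = t ^ d *s (c (l / t + x) + t *s e))"
    using polynomial_curve_at_infinity[OF c_poly c_nz] by blast
  \<comment> \<open>The starting points \<open>c 0\<close> and \<open>c 1\<close> differ only in the
    shift \<open>x\<close>, which does not enter the value at 0.\<close>
  obtain g1 where g1: "polynomial_curve g1" "g1 0 = l q1 ^ d *s a"
    "\<And>t. t \<noteq> 0 \<Longrightarrow> g1 t = t ^ d *s (c (l q1 / t + 0) + t *s e)" using lim[of "l q1" 0 e] by blast
  obtain g2 where g2: "polynomial_curve g2" "g2 0 = l q1 ^ d *s a"
    "\<And>t. t \<noteq> 0 \<Longrightarrow> g2 t = t ^ d *s (c (l q1 / t + 1) + t *s e)" using lim[of "l q1" 1 e] by blast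
  show ?thesis
  proof (rule contracting_automorphism[where \<theta> = "\<Theta> 1" and \<theta>' = "\<Theta> (- 1)" and ?q1.0 = "c 0"
        and ?q2.0 = "c 1" and r = e and ?g1.0 = g1 and ?g2.0 = g2 and S = "{0}"])
    \<comment> \<open>Since \<open>l\<close> has the same non-zero value at both points,
      proportional would mean equal, and then \<open>\<rho> 1\<close> would move \<open>q1\<close>
      only along \<open>e\<close>.\<close>
    show "abs_proj (c 0) \<noteq> abs_proj (c 1)"
    proof
      assume "abs_proj (c 0) = abs_proj (c 1)"
      then obtain k where k: "c 1 = k *s c 0" using abs_proj_eq_iff[OF c_nz c_nz] by blast
      then have "l q1 = k * l q1" using form_homogeneous[OF l(1), of k "c 0"] lc[of 0] lc[of 1] by simp
      then have "c 1 = q1" using k q1(3) c0 by simp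
      then have "\<rho> 1 q1 = q1 + (?F (\<rho> 1 q1) / Q q1) *s e"
        by (simp add: c_def vec_eq_iff algebra_simps)
      then show False using \<rho>1[OF q1(3)] by blast
    qed
    show "g1 0 \<noteq> 0" using a q1(3) g1(2) by simp
    show "\<exists>a. a \<noteq> 0 \<and> g1 t = a *s \<Theta> 1 (c 0 + t *s e)"
      "\<exists>a. a \<noteq> 0 \<and> g2 t = a *s \<Theta> 1 (c 1 + t *s e)"
      "?F (c 0 + t *s e) \<noteq> 0 \<and> ?F (c 1 + t *s e) \<noteq> 0" if "t \<notin> {0}" for t
      using that g1(3) g2(3) \<Theta>c[of t] q1(2)
      by (auto intro!: exI[of _ "t ^ d"] simp: FQ Fc Qc)
  qed (use F \<Theta> F\<Theta> inv\<Theta>[of 1] inv\<Theta>[of "- 1"] c_nz g1 g2 in auto)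
qed

section \<open>Unipotent groups preserving a quadratic form\<close>

text \<open>Let \<open>L\<close> be the polar form of \<open>Q\<close> against the isotropic vector
  \<open>v\<close>. If \<open>L = 0\<close>, transvections along \<open>v\<close> preserve
  \<open>Q\<close>; otherwise Eichler transformations attached to \<open>v\<close> and some
  \<open>n\<close> with \<open>L n = 0\<close> do. The coordinate conditions secure independence of
  \<open>e\<close>, \<open>v\<close> and \<open>n\<close>.\<close>

lemma quadric_singular_point_non_extendable_automorphism:
  fixes F :: "('k::alg_closed_field, 'n::finite) mpol"
  assumes F: "homogeneous 3 F" and Q: "form 2 Q"
    and FQ: "\<And>q t. mpol_eval F (q + t *s e) = mpol_eval F q + t * Q q"
    and Q_nz: "Q b \<noteq> 0" and v: "Q v = 0"
    and j: "e $ j \<noteq> 0" "v $ j = 0" and k: "k \<noteq> j" "v $ k = 0"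
    and i: "i \<noteq> j" "i \<noteq> k" "i \<noteq> i'" "i' \<noteq> j" "i' \<noteq> k" "v $ i' \<noteq> 0"
  shows "\<exists>\<phi>\<in>Aut (UNIV - zero_locus F).
    \<not> (\<exists>\<psi>\<in>Aut UNIV. \<forall>p\<in>UNIV - zero_locus F. \<psi> p = \<phi> p)"
proof -
  have Qe: "Q (q + t *s e) = Q q" for q t by (rule line_coefficient_invariant[OF FQ])
  have Q0: "Q 0 = 0" by (rule form_eq_0_at_0[OF Q]) simp
  have Qe0: "Q e = 0" using Qe[of 0 1] Q0 by simp
  obtain L where L: "form 1 L" and QL: "\<And>q t. Q (q + t *s v) = Q q + t * L q"
    using quadratic_form_line[OF Q, of v] v by auto
  have Lv: "L v = 0"
  proof -
    have "v + 1 *s v = 2 *s v" by (simp add: vec_eq_iff)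
    then have "Q (v + 1 *s v) = 2\<^sup>2 * Q v" using form_homogeneous[OF Q] by metis
    then show ?thesis using QL[of v 1] v by simp
  qed
  have Le: "L e = 0" using QL[of e 1] Qe[of v 1] v Qe0 by (simp add: add.commute)
  show ?thesis
  proof (cases "\<forall>q. L q = 0")
    case True
    \<comment> \<open>This form kills \<open>e\<close> by construction and \<open>v\<close> because
      its coordinates \<open>j\<close> and \<open>k\<close> vanish.\<close>
    define l where "l q = e $ j * q $ k - e $ k * q $ j" for q
    have l: "form 1 l" unfolding l_def by (intro form_diff form_scale form_coord)
    have le: "l e = 0" and lv: "l v = 0" by (simp_all add: l_def j k)
    define D where "D s q = l q *s v" for s :: 'k and q
    have "l (axis k 1) = e $ j" using k by (simp add: l_def axis_def)
    then have lk: "l (axis k 1) \<noteq> 0" using j by simp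
    have l\<rho>: "l (q + t *s v) = l q" for q t by (simp add: linear_form_line[OF l] lv)
    show ?thesis
    proof (rule unipotent_non_extendable_automorphism[OF F Q FQ l le lk Q_nz, of D])
      show "parametric_form 1 (\<lambda>s q. D s q $ i)" for i
      proof -
        have "parametric_form 1 (\<lambda>s :: 'k. \<lambda>q. v $ i * l q)"
          by (intro parametric_form.form form_scale l)
        then show ?thesis by (simp add: D_def mult.commute)
      qed
      show "(\<lambda>s q. q + (s * l q) *s v) = (\<lambda>s q. q + s *s D s q)" by (simp add: D_def)
      show "Q (q + (s * l q) *s v) = Q q" "l (q + (s * l q) *s v) = l q" for s q
        using QL True l\<rho> by simp_all
      show "q + (t * l q) *s v + (s * l (q + (t * l q) *s v)) *s v = q + ((s + t) * l q) *s v" for s t q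
        by (simp add: l\<rho>) (simp add: vec_eq_iff algebra_simps)
      show "q + t *s e + (s * l (q + t *s e)) *s v = q + (s * l q) *s v + t *s e" for s t q
        by (simp add: linear_form_line[OF l] le)
      show "q + (1 * l q) *s v \<noteq> q + t *s e" if "l q \<noteq> 0" for q t
      proof
        assume "q + (1 * l q) *s v = q + t *s e"
        then have *: "l q *s v = t *s e" by simp
        then have "t * e $ j = 0" using j(2) by (metis mult_zero_right vector_smult_component)
        then have "l q * v $ i' = 0" using * j(1) by (metis mult_eq_0_iff vector_smult_component)
        then show False using that i by simp
      qed
    qed
  next
    case False
    then obtain a where La: "L a \<noteq> 0" by blast
    \<comment> \<open>A vector in the kernel of \<open>L\<close> outside the span of
      \<open>e\<close> and \<open>v\<close>: its coordinate \<open>j\<close> is 0, and the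
      coordinates \<open>k\<close>, or \<open>i\<close> and \<open>i'\<close>, tell it from
      multiples of \<open>v\<close>.\<close>
    define n where "n = (if L (axis k 1) = 0 then axis k 1
      else L (axis k 1) *s axis i 1 + (- L (axis i 1)) *s axis k 1)"
    have "L (x *s u + y *s w) = x * L u + y * L w" for x y u w
      using form_homogeneous[OF L, of x u] by (simp only: linear_form_line[OF L]) simp
    note L_comb = this
    have Ln: "L n = 0"
    proof (cases "L (axis k 1) = 0")
      case False
      then have "n = L (axis k 1) *s axis i 1 + (- L (axis i 1)) *s axis k 1" by (simp add: n_def)
      then show ?thesis by (simp only: L_comb) simp
    qed (simp add: n_def)
    have indep: False if "x *s n + y *s v = t *s e" "x \<noteq> 0" for x y t
    proof -
      have c: "x * n $ m + y * v $ m = t * e $ m" for m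
        using arg_cong[OF that(1), of "\<lambda>w. w $ m"] by simp
      have "n $ j = 0" using i k by (simp add: n_def axis_def)
      then have t: "t = 0" using c[of j] j by simp
      show False
      proof (cases "L (axis k 1) = 0")
        case True
        then show False using c[of k] k t that(2) by (simp add: n_def)
      next
        case False
        then have "y = 0" using c[of i'] i k t by (simp add: n_def axis_def)
        then show False using c[of i] False i k t that(2) by (simp add: n_def axis_def)
      qed
    qed
    obtain B where B: "form 1 B" and QB: "\<And>q t. Q (q + t *s n) = Q q + t * B q + t\<^sup>2 * Q n"
      using quadratic_form_line[OF Q, of n] by blast
    have Bv: "B v = 0" using QB[of v 1] QL[of n 1] v Ln by (simp add: add.commute)
    have Be: "B e = 0" using QB[of e 1] Qe[of n 1] Qe0 by (simp add: add.commute)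
    have Bn: "B n = 2 * Q n"
    proof -
      have "n + 1 *s n = 2 *s n" by (simp add: vec_eq_iff)
      then have "Q (n + 1 *s n) = 2\<^sup>2 * Q n" using form_homogeneous[OF Q] by metis
      then show ?thesis using QB[of n 1] by (simp add: algebra_simps)
    qed
    \<comment> \<open>Moving by \<open>s * L q\<close> along \<open>n\<close> changes
      \<open>Q\<close> by \<open>s * L q * B q + s\<^sup>2 * (L q)\<^sup>2 * Q n\<close>; moving by
      \<kappa> along \<open>v\<close> adds \<open>\<kappa> s q * L q\<close>, which cancels
      this.\<close>
    define \<kappa> where "\<kappa> s q = - (s * B q + s\<^sup>2 * L q * Q n)" for s q
    define \<rho> where "\<rho> s q = q + (s * L q) *s n + \<kappa> s q *s v" for s q
    define D where "D s q = L q *s n - (B q + s * (Q n * L q)) *s v" for s q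
    have L\<rho>: "L (\<rho> s q) = L q" for s q by (simp add: \<rho>_def linear_form_line[OF L] Ln Lv)
    have B\<rho>: "B (\<rho> s q) = B q + 2 * s * L q * Q n" for s q
      by (simp add: \<rho>_def linear_form_line[OF B] Bn Bv)
    show ?thesis
    proof (rule unipotent_non_extendable_automorphism[OF F Q FQ L Le La Q_nz, of D \<rho>])
      show "parametric_form 1 (\<lambda>s q. D s q $ i)" for i
      proof -
        have "parametric_form 1 (\<lambda>s q. s * (Q n * L q))"
          by (rule parametric_form_mult'[OF parametric_form.param
                parametric_form.form[OF form_scale[OF L]]]) simp
        then have "parametric_form 1 (\<lambda>s q. n $ i * L q - v $ i * (B q + s * (Q n * L q)))"
          by (intro parametric_form_diff parametric_form_const_mult parametric_form.add
              parametric_form.form form_scale L B)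
        moreover have "(\<lambda>s q. D s q $ i) =
            (\<lambda>s q. n $ i * L q - v $ i * (B q + s * (Q n * L q)))"
          by (simp add: D_def fun_eq_iff algebra_simps)
        ultimately show ?thesis by simp
      qed
      show "\<rho> = (\<lambda>s q. q + s *s D s q)"
        by (intro ext) (simp add: \<rho>_def \<kappa>_def D_def vec_eq_iff power2_eq_square algebra_simps)
      show "Q (\<rho> s q) = Q q" for s q
        unfolding \<rho>_def QL QB linear_form_line[OF L] Ln \<kappa>_def
        by (simp add: power2_eq_square algebra_simps)
      show "L (\<rho> s q) = L q" for s q by (rule L\<rho>)
      show "\<rho> s (\<rho> t q) = \<rho> (s + t) q" for s t q
      proof -
        \<comment> \<open>The change \<open>2 * t * L q * Q n\<close> of \<open>B\<close> supplies
          the mixed term of \<open>(s + t)\<^sup>2\<close>.\<close>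
        have "\<kappa> s (\<rho> t q) + \<kappa> t q = \<kappa> (s + t) q"
          unfolding \<kappa>_def L\<rho> B\<rho> by (simp add: power2_eq_square algebra_simps)
        then have "\<kappa> (s + t) q *s v = \<kappa> s (\<rho> t q) *s v + \<kappa> t q *s v"
          by (simp flip: vector_sadd_rdistrib)
        then show ?thesis
          unfolding \<rho>_def[of s] L\<rho> unfolding \<rho>_def[of t] \<rho>_def[of "s + t"]
          by (simp add: \<rho>_def vec_eq_iff algebra_simps)
      qed
      show "\<rho> s (q + t *s e) = \<rho> s q + t *s e" for s t q
        by (simp add: \<rho>_def \<kappa>_def linear_form_line[OF L] linear_form_line[OF B] Le Be)
      show "\<rho> 1 q \<noteq> q + t *s e" if "L q \<noteq> 0" for q t
        using indep[of "L q" "\<kappa> 1 q" t] that by (auto simp: \<rho>_def add.assoc)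
    qed
  qed
qed

lemma distinct_indices_4: "\<exists>i i' k :: 4. distinct [j, i, i', k]"
proof -
  have "card (UNIV - {j}) = 3" by (simp add: card_Diff_singleton)
  then obtain i i' k where "UNIV - {j} = {i, i', k}" "i \<noteq> i'" "i \<noteq> k" "i' \<noteq> k"
    using card_3_iff by metis
  then have "distinct [j, i, i', k]" by auto
  then show ?thesis by blast
qed

theorem proposition5p22:
  fixes F :: "('k::alg_closed_field, 4) mpol" and X :: "('k, 4) proj set"
  assumes "homogeneous 3 F" and "irreducible F" and "X = zero_locus F"
    and "\<exists>p. singular_point F p"
  shows "\<exists>\<phi> \<in> Aut (UNIV - X). \<not> (\<exists>\<psi> \<in> Aut UNIV. \<forall>p \<in> UNIV - X. \<psi> p = \<phi> p)"
proof -
  note F = assms(1)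
  have Ff: "form 3 (mpol_eval F)" using F by (rule form_mpol_eval)
  obtain p where p: "singular_point F p" using assms(4) by blast
  obtain e where e: "e \<noteq> 0" "p = abs_proj e" by (rule proj_exhaust)
  have "e \<in> hom_coords p" using e by (simp add: hom_coords_def)
  then have "mpol_eval F e = 0" "\<And>i. mpol_eval (partial_deriv i F) e = 0"
    using p by (auto simp: singular_point_def zero_locus_def)
  then obtain Q where Q: "form 2 Q" "\<And>q t. mpol_eval F (q + t *s e) = mpol_eval F q + t * Q q"
    using cubic_form_line_singular[OF F] by blast
  obtain j where j: "e $ j \<noteq> 0" using e(1) by (auto simp: vec_eq_iff)
  obtain i i' k where d: "j \<noteq> i" "j \<noteq> i'" "j \<noteq> k" "i \<noteq> i'" "i \<noteq> k" "i' \<noteq> k"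
    using distinct_indices_4[of j] by auto
  have coords: "(s *s axis i 1 + t *s axis i' 1 :: 'k ^ 4) $ m =
      (if m = i then s else if m = i' then t else 0)" for s t m
    using d by (simp add: axis_def)
  show ?thesis
  proof (cases "\<exists>b. Q b \<noteq> 0")
    case True
    then obtain b where b: "Q b \<noteq> 0" by blast
    \<comment> \<open>Searching in the span of two axes leaves the coordinates \<open>j\<close> and
      \<open>k\<close> of the zero equal to 0.\<close>
    obtain s t where st: "s \<noteq> 0 \<or> t \<noteq> 0" "Q (s *s axis i 1 + t *s axis i' 1) = 0"
      using form_zero_on_pencil[OF Q(1), of "axis i 1" "axis i' 1"] by auto
    define v where "v = (s *s axis i 1 + t *s axis i' 1 :: 'k ^ 4)"
    note v = coords[of s t, folded v_def]
    have "Q v = 0" using st by (simp add: v_def)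
    note * = quadric_singular_point_non_extendable_automorphism[OF F Q b this j, of k]
    show ?thesis
    \<comment> \<open>The place of \<open>i'\<close> in the lemma needs a non-zero coordinate of
      \<open>v\<close>, so \<open>i\<close> and \<open>i'\<close> change roles if
      \<open>t = 0\<close>.\<close>
    proof (cases "t = 0")
      case True
      then show ?thesis using *[of i' i] st(1) d assms(3) by (simp add: v)
    next
      case False
      then show ?thesis using *[of i i'] d assms(3) by (simp add: v)
    qed
  next
    case False
    obtain r where r: "mpol_eval F r \<noteq> 0"
      using mpol_eval_nonzero[of F] assms(2) by (auto simp: irreducible_def)
    obtain s t where st: "s \<noteq> 0 \<or> t \<noteq> 0" "mpol_eval F (s *s axis i 1 + t *s axis i' 1) = 0"
      using form_zero_on_pencil[OF Ff, of "axis i 1" "axis i' 1"] by auto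
    define v where "v = (s *s axis i 1 + t *s axis i' 1 :: 'k ^ 4)"
    note v = coords[of s t, folded v_def]
    define m where "m = (if s = 0 then i' else i)"
    have "v $ m \<noteq> 0" "v $ j = 0" using st(1) d by (auto simp: v m_def)
    \<comment> \<open>At \<open>v\<close> this has the value \<open>e $ j * v $ m\<close>, because
      \<open>v $ j = 0\<close>.\<close>
    define l where "l q = e $ j * q $ m - e $ m * q $ j" for q
    have "form 1 l" unfolding l_def by (intro form_diff form_scale form_coord)
    moreover have "l e = 0" "l v \<noteq> 0" using j \<open>v $ m \<noteq> 0\<close> \<open>v $ j = 0\<close> by (auto simp: l_def)
    moreover have "mpol_eval F (q + t *s e) = mpol_eval F q" for q t using Q(2) False by simp
    moreover have "mpol_eval F v = 0" using st(2) by (simp add: v_def)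
    ultimately show ?thesis
      unfolding assms(3) using cone_non_extendable_automorphism[OF F r] e(1) by blast
  qed
qed

end
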